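(* Let $\mathfrak{g}=\mathrm{span}(\partial_t,L_1,L_2,L_3)$, $L_i=\epsilon_{ijk}x^j\partial_k$, in Cartesian coordinates $(t,x^1,x^2,x^3)$, and let $$V_a=(c_a^0(r)+N_a^0t)\partial_t+d_a^iL_i+f_a(r)x^i\partial_i,\qquad a=1,2,$$ be two commuting vector fields of this form, with constants $N_a^0,d_a^i\in\mathbb{R}$ and functions $c_a^0,f_a$ of $r=\|\mathbf{x}\|$. Then $f_1$ and $f_2$ are parallel in the overlap of their supports, and one of the $f_a$ can always be eliminated locally by a twist conserving map; without loss of generality $f_1(r)=0$ in the classification of local solutions (the local solutions have to be glued together at the end). Moreover $\mathbf{d}_a=\kappa_a\mathbf{d}$ with constants $\kappa_a\in\mathbb{R}$ and some vector $\mathbf{d}=(d^1,d^2,d^3)\neq0$. Up to twist conserving maps, the local solutions are of the following six types: - $\mathfrak{B}_{11}$ ($N_1^0=N_2^0=0$, $f_2=0$): $V_1=c_1^0(r)\partial_t+\kappa_1d^iL_i$, $V_2=c_2^0(r)\partial_t+\kappa_2d^iL_i$; - $\mathfrak{B}_{21}$ ($N_1^0\neq0$, $N_2^0=0$, $f_2=0$): $V_1=(c_1^0(r)+N_1^0t)\partial_t$, $V_2=\kappa_2d^iL_i$; - $\mathfrak{B}_{31}$ ($N_1^0=0$, $N_2^0\neq0$, $f_2=0$): $V_1=\kappa_1d^iL_i$, $V_2=(c_2^0(r)+N_2^0t)\partial_t$; - $\mathfrak{B}_{12}$ ($N_1^0=N_2^0=0$, $f_2\neq0$): $V_1=c_1^0\partial_t+\kappa_1d^iL_i$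 with $c_1^0$ constant, $V_2=c_2^0(r)\partial_t+\kappa_2d^iL_i+f_2(r)x^i\partial_i$; - $\mathfrak{B}_{22}$ ($N_1^0\neq0$, $N_2^0=0$, $f_2\neq0$): $V_1=(c_1^0(r)+N_1^0t)\partial_t+\kappa_1d^iL_i$, $V_2=-\frac{1}{N_1^0}f_2(r)\,r\,c_1^{0\prime}(r)\partial_t+\kappa_2d^iL_i+f_2(r)x^i\partial_i$; - $\mathfrak{B}_{32}$ ($N_1^0=0$, $N_2^0\neq0$, $f_2\neq0$): $V_1=c_1^0(r)\partial_t+\kappa_1d^iL_i$, $V_2=(c_2^0(r)+N_2^0t)\partial_t+\kappa_2d^iL_i+f_2(r)x^i\partial_i$, where $c_1^0$ satisfies $c_1^0(r)=\frac{f_2(r)}{N_2^0}\,r\,c_1^{0\prime}(r)$ for the given arbitrary $f_2$. Other choices of parameters can be mapped by a twist conserving map into these classes. In particular, for analytic functions $f_a(r)$ the twist conserving map transforming $f_1$ to zero, and with it this classification, can be performed globally.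
   Context: Repeated spatial indices are summed over $1,2,3$; $\epsilon_{ijk}$ is the Levi-Civita symbol; $\partial_i=\partial/\partial x^i$; $\|\cdot\|$ is the Euclidean norm; a prime denotes $d/dr$; $[\cdot,\cdot]$ is the Lie bracket. $f_2\neq0$ means that $f_2$ is not the zero function. $\mathfrak{g}$ is the Lie algebra of the symmetry group $\mathbb{R}\times SO(3)$ of a non-rotating black hole; vector fields of the displayed form are those compatible with it, i.e. with $[V_a,\mathfrak{g}]\subseteq\mathfrak{g}$. For two commuting vector fields $V_1,V_2$ the associated twist is the element $\mathcal{F}_V=\exp\bigl(-\frac{i\lambda}{2}(V_1\otimes V_2-V_2\otimes V_1)\bigr)\in U\Xi\otimes U\Xi$, a formal power series in $\lambda$, where $U\Xi$ is the universal enveloping algebra of the Lie algebra $\Xi$ of vector fields. A twist conserving map is a replacement of the pair $(V_1,V_2)$ that leaves $\mathcal{F}_V$ unchanged, for example $V_2\to V_2-\kappa V_1$ with $\kappa\in\mathbb{R}$ constant. *)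

theory Defs
  imports "HOL-Analysis.Analysis" "HOL-Algebra.QuotRing"
begin

subsection \<open>Vector fields in Cartesian coordinates\<close>

type_synonym point = "real \<times> (real^3)"
type_synonym vfield = "point \<Rightarrow> point"

fun differentiable_times_on :: "nat \<Rightarrow> 'a::euclidean_space set \<Rightarrow> ('a \<Rightarrow> 'b::euclidean_space) \<Rightarrow> bool" where
  "differentiable_times_on 0 S X = continuous_on S X"
| "differentiable_times_on (Suc k) S X =
     ((\<forall>p\<in>S. X differentiable (at p)) \<and>
      (\<forall>v. differentiable_times_on k S (\<lambda>p. frechet_derivative X (at p) v)))"

definition smooth_on :: "'a::euclidean_space set \<Rightarrow> ('a \<Rightarrow> 'b::euclidean_space) \<Rightarrow> bool" where
  "smooth_on S X = (\<forall>k. differentiable_times_on k S X)"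

text \<open>Smooth vector fields on an open set \<open>S\<close>. Fields are set to 0 outside \<open>S\<close>, so that equality of
  vector fields on \<open>S\<close> is equality of functions.\<close>
definition vfields :: "point set \<Rightarrow> vfield set" where
  "vfields S = {X. smooth_on S X \<and> (\<forall>p. p \<notin> S \<longrightarrow> X p = 0)}"

definition lie_bracket :: "point set \<Rightarrow> vfield \<Rightarrow> vfield \<Rightarrow> vfield" where
  "lie_bracket S X Y = (\<lambda>p. if p \<in> S then frechet_derivative Y (at p) (X p)
                                            - frechet_derivative X (at p) (Y p) else 0)"

definition commuting_fields :: "point set \<Rightarrow> vfield \<Rightarrow> vfield \<Rightarrow> bool" where
  "commuting_fields S X Y \<longleftrightarrow> X \<in> vfields S \<and> Y \<in> vfields S \<and> lie_bracket S X Y = (\<lambda>_. 0)"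

definition partial_t :: vfield where
  "partial_t p = (1, 0)"

definition partial_x :: "3 \<Rightarrow> vfield" where
  "partial_x i p = (0, axis i 1)"

definition levi_civita :: "3 \<Rightarrow> 3 \<Rightarrow> 3 \<Rightarrow> real" where
  "levi_civita i j k =
     (if (i, j, k) \<in> {(1, 2, 3), (2, 3, 1), (3, 1, 2)} then 1
      else if (i, j, k) \<in> {(3, 2, 1), (2, 1, 3), (1, 3, 2)} then - 1 else 0)"

definition rotation :: "3 \<Rightarrow> vfield" where
  "rotation i p = (\<Sum>j\<in>UNIV. \<Sum>k\<in>UNIV. (levi_civita i j k * snd p $ j) *\<^sub>R partial_x k p)"

text \<open>The part of spacetime where the radius \<open>r = norm x\<close> lies in \<open>J\<close>.\<close>
definition shell :: "real set \<Rightarrow> point set" where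
  "shell J = {p. norm (snd p) \<in> J}"

text \<open>The vector field \<open>(c(r) + N t) \<partial>\<^sub>t + d\<^sup>i L\<^sub>i + f(r) x\<^sup>i \<partial>\<^sub>i\<close> on the shell over \<open>J\<close>.\<close>
definition bh_field :: "real set \<Rightarrow> (real \<Rightarrow> real) \<Rightarrow> real \<Rightarrow> real^3 \<Rightarrow> (real \<Rightarrow> real) \<Rightarrow> vfield" where
  "bh_field J c N d f = (\<lambda>p. if p \<in> shell J then
       (c (norm (snd p)) + N * fst p) *\<^sub>R partial_t p
       + (\<Sum>i\<in>UNIV. (d $ i) *\<^sub>R rotation i p)
       + (\<Sum>i\<in>UNIV. (f (norm (snd p)) * snd p $ i) *\<^sub>R partial_x i p)
     else 0)"


subsection \<open>Enveloping algebra, tensor product, twist\<close>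

text \<open>The monoid algebra over the complex numbers: finitely supported functions with convolution.\<close>
definition monoid_algebra :: "('g, 'm) monoid_scheme \<Rightarrow> ('g \<Rightarrow> complex) ring" where
  "monoid_algebra G =
    \<lparr>carrier = {f. finite {x. f x \<noteq> 0} \<and> {x. f x \<noteq> 0} \<subseteq> carrier G},
     mult = (\<lambda>f g z. \<Sum>x\<in>{x. f x \<noteq> 0}. \<Sum>y\<in>{y. g y \<noteq> 0}.
                       if x \<otimes>\<^bsub>G\<^esub> y = z then f x * g y else 0),
     one = (\<lambda>z. if z = \<one>\<^bsub>G\<^esub> then 1 else 0),
     zero = (\<lambda>z. 0),
     add = (\<lambda>f g z. f z + g z)\<rparr>"

definition ma_term :: "complex \<Rightarrow> 'g \<Rightarrow> 'g \<Rightarrow> complex" where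
  "ma_term a g = (\<lambda>z. if z = g then a else 0)"

definition words :: "'a set \<Rightarrow> 'a list monoid" where
  "words A = \<lparr>carrier = lists A, mult = (@), one = []\<rparr>"

text \<open>The universal enveloping algebra of \<open>vfields S\<close> over the complex numbers: the free algebra on the
  set \<open>vfields S\<close> modulo real linearity of the generators and \<open>X Y - Y X = [X, Y]\<close>.\<close>
abbreviation free_alg :: "point set \<Rightarrow> (vfield list \<Rightarrow> complex) ring" where
  "free_alg S \<equiv> monoid_algebra (words (vfields S))"

definition env_relations :: "point set \<Rightarrow> (vfield list \<Rightarrow> complex) set" where
  "env_relations S =
     {ma_term 1 [\<lambda>p. X p + Y p] \<ominus>\<^bsub>free_alg S\<^esub> (ma_term 1 [X] \<oplus>\<^bsub>free_alg S\<^esub> ma_term 1 [Y])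
        | X Y. X \<in> vfields S \<and> Y \<in> vfields S}
   \<union> {ma_term 1 [\<lambda>p. a *\<^sub>R X p] \<ominus>\<^bsub>free_alg S\<^esub> ma_term (complex_of_real a) [X]
        | a X. X \<in> vfields S}
   \<union> {(ma_term 1 [X, Y] \<ominus>\<^bsub>free_alg S\<^esub> ma_term 1 [Y, X]) \<ominus>\<^bsub>free_alg S\<^esub> ma_term 1 [lie_bracket S X Y]
        | X Y. X \<in> vfields S \<and> Y \<in> vfields S}"

definition env_ideal :: "point set \<Rightarrow> (vfield list \<Rightarrow> complex) set" where
  "env_ideal S = Idl\<^bsub>free_alg S\<^esub> (env_relations S)"

definition env_alg :: "point set \<Rightarrow> (vfield list \<Rightarrow> complex) set ring" where
  "env_alg S = free_alg S Quot env_ideal S"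

definition env_incl :: "point set \<Rightarrow> vfield \<Rightarrow> (vfield list \<Rightarrow> complex) set" where
  "env_incl S X = env_ideal S +>\<^bsub>free_alg S\<^esub> ma_term 1 [X]"

definition env_scalar :: "point set \<Rightarrow> complex \<Rightarrow> (vfield list \<Rightarrow> complex) set" where
  "env_scalar S a = env_ideal S +>\<^bsub>free_alg S\<^esub> ma_term a []"

text \<open>The tensor product over the complex numbers of two algebras \<open>A\<close>, \<open>B\<close> with unit maps \<open>\<alpha>\<close>, \<open>\<beta>\<close>:
  formal combinations of pairs, multiplied componentwise, modulo bilinearity.\<close>
definition tensor_relations ::
  "'a ring \<Rightarrow> (complex \<Rightarrow> 'a) \<Rightarrow> 'b ring \<Rightarrow> (complex \<Rightarrow> 'b) \<Rightarrow> ('a \<times> 'b \<Rightarrow> complex) set" where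
  "tensor_relations A \<alpha> B \<beta> = (let M = monoid_algebra (A \<times>\<times> B) in
     {ma_term 1 (a \<oplus>\<^bsub>A\<^esub> a', b) \<ominus>\<^bsub>M\<^esub> (ma_term 1 (a, b) \<oplus>\<^bsub>M\<^esub> ma_term 1 (a', b))
        | a a' b. a \<in> carrier A \<and> a' \<in> carrier A \<and> b \<in> carrier B}
   \<union> {ma_term 1 (a, b \<oplus>\<^bsub>B\<^esub> b') \<ominus>\<^bsub>M\<^esub> (ma_term 1 (a, b) \<oplus>\<^bsub>M\<^esub> ma_term 1 (a, b'))
        | a b b'. a \<in> carrier A \<and> b \<in> carrier B \<and> b' \<in> carrier B}
   \<union> {ma_term 1 (\<alpha> s \<otimes>\<^bsub>A\<^esub> a, b) \<ominus>\<^bsub>M\<^esub> ma_term s (a, b)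
        | s a b. a \<in> carrier A \<and> b \<in> carrier B}
   \<union> {ma_term 1 (a, \<beta> s \<otimes>\<^bsub>B\<^esub> b) \<ominus>\<^bsub>M\<^esub> ma_term s (a, b)
        | s a b. a \<in> carrier A \<and> b \<in> carrier B})"

definition tensor_ideal ::
  "'a ring \<Rightarrow> (complex \<Rightarrow> 'a) \<Rightarrow> 'b ring \<Rightarrow> (complex \<Rightarrow> 'b) \<Rightarrow> ('a \<times> 'b \<Rightarrow> complex) set" where
  "tensor_ideal A \<alpha> B \<beta> = Idl\<^bsub>monoid_algebra (A \<times>\<times> B)\<^esub> (tensor_relations A \<alpha> B \<beta>)"

definition tensor_alg ::
  "'a ring \<Rightarrow> (complex \<Rightarrow> 'a) \<Rightarrow> 'b ring \<Rightarrow> (complex \<Rightarrow> 'b) \<Rightarrow> ('a \<times> 'b \<Rightarrow> complex) set ring" where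
  "tensor_alg A \<alpha> B \<beta> = monoid_algebra (A \<times>\<times> B) Quot tensor_ideal A \<alpha> B \<beta>"

type_synonym env_elem = "(vfield list \<Rightarrow> complex) set"

abbreviation UU :: "point set \<Rightarrow> (env_elem \<times> env_elem \<Rightarrow> complex) set ring" where
  "UU S \<equiv> tensor_alg (env_alg S) (env_scalar S) (env_alg S) (env_scalar S)"

definition UU_tensor ::
  "point set \<Rightarrow> env_elem \<Rightarrow> env_elem \<Rightarrow> (env_elem \<times> env_elem \<Rightarrow> complex) set" where
  "UU_tensor S a b = tensor_ideal (env_alg S) (env_scalar S) (env_alg S) (env_scalar S)
                       +>\<^bsub>monoid_algebra (env_alg S \<times>\<times> env_alg S)\<^esub> ma_term 1 (a, b)"

definition UU_scalar :: "point set \<Rightarrow> complex \<Rightarrow> (env_elem \<times> env_elem \<Rightarrow> complex) set" where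
  "UU_scalar S s = UU_tensor S (env_scalar S s) \<one>\<^bsub>env_alg S\<^esub>"

text \<open>The twist \<open>exp (- (\<i> \<lambda> / 2) (V\<^sub>1 \<otimes> V\<^sub>2 - V\<^sub>2 \<otimes> V\<^sub>1))\<close>, a formal power series in \<open>\<lambda>\<close> over the
  tensor square of the enveloping algebra, given by its sequence of coefficients.\<close>
definition twist :: "point set \<Rightarrow> vfield \<Rightarrow> vfield \<Rightarrow> nat \<Rightarrow> (env_elem \<times> env_elem \<Rightarrow> complex) set" where
  "twist S V1 V2 n =
     UU_scalar S ((- \<i> / 2) ^ n / fact n) \<otimes>\<^bsub>UU S\<^esub>
     (UU_tensor S (env_incl S V1) (env_incl S V2) \<ominus>\<^bsub>UU S\<^esub>
      UU_tensor S (env_incl S V2) (env_incl S V1)) [^]\<^bsub>UU S\<^esub> n"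

text \<open>\<open>(V1, V2)\<close> is replaced by \<open>(W1, W2)\<close>; both are commuting pairs, as the twist requires.\<close>
definition twist_conserving ::
  "point set \<Rightarrow> vfield \<Rightarrow> vfield \<Rightarrow> vfield \<Rightarrow> vfield \<Rightarrow> bool" where
  "twist_conserving S V1 V2 W1 W2 \<longleftrightarrow>
     commuting_fields S V1 V2 \<and> commuting_fields S W1 W2 \<and> twist S V1 V2 = twist S W1 W2"


subsection \<open>The six types\<close>

definition type_B11 :: "real set \<Rightarrow> real^3 \<Rightarrow> vfield \<Rightarrow> vfield \<Rightarrow> bool" where
  "type_B11 J d V1 V2 \<longleftrightarrow> (\<exists>c1 c2 \<kappa>1 \<kappa>2.
     V1 = bh_field J c1 0 (\<kappa>1 *\<^sub>R d) (\<lambda>r. 0) \<and>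
     V2 = bh_field J c2 0 (\<kappa>2 *\<^sub>R d) (\<lambda>r. 0))"

definition type_B21 :: "real set \<Rightarrow> real^3 \<Rightarrow> vfield \<Rightarrow> vfield \<Rightarrow> bool" where
  "type_B21 J d V1 V2 \<longleftrightarrow> (\<exists>c1 N1 \<kappa>2. N1 \<noteq> 0 \<and>
     V1 = bh_field J c1 N1 0 (\<lambda>r. 0) \<and>
     V2 = bh_field J (\<lambda>r. 0) 0 (\<kappa>2 *\<^sub>R d) (\<lambda>r. 0))"

definition type_B31 :: "real set \<Rightarrow> real^3 \<Rightarrow> vfield \<Rightarrow> vfield \<Rightarrow> bool" where
  "type_B31 J d V1 V2 \<longleftrightarrow> (\<exists>c2 N2 \<kappa>1. N2 \<noteq> 0 \<and>
     V1 = bh_field J (\<lambda>r. 0) 0 (\<kappa>1 *\<^sub>R d) (\<lambda>r. 0) \<and>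
     V2 = bh_field J c2 N2 0 (\<lambda>r. 0))"

definition type_B12 :: "real set \<Rightarrow> real^3 \<Rightarrow> vfield \<Rightarrow> vfield \<Rightarrow> bool" where
  "type_B12 J d V1 V2 \<longleftrightarrow> (\<exists>c1 c2 \<kappa>1 \<kappa>2 f2. (\<exists>r\<in>J. f2 r \<noteq> 0) \<and>
     V1 = bh_field J (\<lambda>r. c1) 0 (\<kappa>1 *\<^sub>R d) (\<lambda>r. 0) \<and>
     V2 = bh_field J c2 0 (\<kappa>2 *\<^sub>R d) f2)"

definition type_B22 :: "real set \<Rightarrow> real^3 \<Rightarrow> vfield \<Rightarrow> vfield \<Rightarrow> bool" where
  "type_B22 J d V1 V2 \<longleftrightarrow> (\<exists>c1 N1 \<kappa>1 \<kappa>2 f2. N1 \<noteq> 0 \<and> (\<exists>r\<in>J. f2 r \<noteq> 0) \<and>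
     V1 = bh_field J c1 N1 (\<kappa>1 *\<^sub>R d) (\<lambda>r. 0) \<and>
     V2 = bh_field J (\<lambda>r. - (1 / N1) * f2 r * r * deriv c1 r) 0 (\<kappa>2 *\<^sub>R d) f2)"

definition type_B32 :: "real set \<Rightarrow> real^3 \<Rightarrow> vfield \<Rightarrow> vfield \<Rightarrow> bool" where
  "type_B32 J d V1 V2 \<longleftrightarrow> (\<exists>c1 c2 N2 \<kappa>1 \<kappa>2 f2. N2 \<noteq> 0 \<and> (\<exists>r\<in>J. f2 r \<noteq> 0) \<and>
     (\<forall>r\<in>J. c1 r = f2 r / N2 * r * deriv c1 r) \<and>
     V1 = bh_field J c1 0 (\<kappa>1 *\<^sub>R d) (\<lambda>r. 0) \<and>
     V2 = bh_field J c2 N2 (\<kappa>2 *\<^sub>R d) f2)"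

definition of_six_types :: "real set \<Rightarrow> real^3 \<Rightarrow> vfield \<Rightarrow> vfield \<Rightarrow> bool" where
  "of_six_types J d V1 V2 \<longleftrightarrow>
     type_B11 J d V1 V2 \<or> type_B21 J d V1 V2 \<or> type_B31 J d V1 V2 \<or>
     type_B12 J d V1 V2 \<or> type_B22 J d V1 V2 \<or> type_B32 J d V1 V2"

definition f1_eliminable :: "real set \<Rightarrow> vfield \<Rightarrow> vfield \<Rightarrow> bool" where
  "f1_eliminable J V1 V2 \<longleftrightarrow> (\<exists>c1 N1 d1 c2 N2 d2 f2.
     twist_conserving (shell J) V1 V2 (bh_field J c1 N1 d1 (\<lambda>r. 0)) (bh_field J c2 N2 d2 f2))"

definition classified :: "real set \<Rightarrow> real^3 \<Rightarrow> vfield \<Rightarrow> vfield \<Rightarrow> bool" where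
  "classified J d V1 V2 \<longleftrightarrow>
     (\<exists>W1 W2. twist_conserving (shell J) V1 V2 W1 W2 \<and> of_six_types J d W1 W2)"

text \<open>The open radial intervals on which local solutions are classified. Where \<open>f1\<close>, \<open>f2\<close> have a common
  zero that is not interior to their common zero set, a constant linear combination that vanishes on one
  side need not vanish on the other (for functions flat at the zero), so no neighbourhood of such a
  radius is used; the remaining radii are dense in \<open>I\<close>.\<close>
definition local_interval :: "real set \<Rightarrow> (real \<Rightarrow> real) \<Rightarrow> (real \<Rightarrow> real) \<Rightarrow> real set \<Rightarrow> bool" where
  "local_interval I f1 f2 J \<longleftrightarrow> open J \<and> connected J \<and> J \<noteq> {} \<and> J \<subseteq> I \<and>
     ((\<forall>r\<in>J. f1 r \<noteq> 0 \<or> f2 r \<noteq> 0) \<or> (\<forall>r\<in>J. f1 r = 0 \<and> f2 r = 0))"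

definition real_analytic_on :: "(real \<Rightarrow> real) \<Rightarrow> real set \<Rightarrow> bool" where
  "real_analytic_on f I \<longleftrightarrow>
     (\<forall>x\<in>I. \<exists>a e. e > 0 \<and> (\<forall>y. \<bar>y - x\<bar> < e \<longrightarrow> (\<lambda>n. a n * (y - x) ^ n) sums f y))"

end

(* Proof idea. Writing bh_field as (c(r) + N t, d \<times> x + f(r) x), the bracket of two such fields has time
   component N2 c1 - N1 c2 + r (f1 c2' - f2 c1') and space component r (f1 f2' - f2 f1') x - (d1 \<times> d2) \<times> x,
   so commuting means three separate conditions: d1 and d2 are parallel, the Wronskian of f1, f2 vanishes,
   and one first order equation holds for c1, c2. A vanishing Wronskian makes (f1, f2) proportional wherever
   it has no zero, or globally in the analytic case.
   The exponent V1 \<otimes> V2 - V2 \<otimes> V1 of the twist is biadditive, alternating and real homogeneous, hence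
   invariant under V1 + a V2, V2 + a V1 and (V1, V2) \<mapsto> (V2, -V1). These moves first remove f1, then make at
   most one of N1, N2 nonzero, after which the equation for c1, c2 is the one defining each type. *)
theory Submission
  imports Defs "HOL-Complex_Analysis.Cauchy_Integral_Formula"
begin

text \<open>Twist conserving moves have constant coefficients, so pointwise parallel
  \<open>f1\<close> and \<open>f2\<close> are not enough: one relation
  \<open>a * f1 + b * f2 = 0\<close> must hold on the whole interval. For flat functions the
  constants can change across a common zero. The local and the analytic situation are both reduced
  to the same data: such a relation, together with the alternative that each radial coefficient
  vanishes identically or has only isolated zeros. The alternative is needed because the commutation
  equation says nothing about \<open>deriv c1\<close> at a zero of \<open>f2\<close>. One case
  resists linear moves: when the second field is reduced to zero, nothing is left that could cancel
  the rotation in the first. There the triviality of the twist takes over. The algebra enters only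
  through equalities of cosets, that is, through the ring structure of the quotients and their
  defining relations. One ring proof for monoid algebras serves both the words and the
  pairs.\<close>

subsection \<open>The monoid algebra\<close>

text \<open>Convolution is defined by sums over the exact supports. Larger finite index sets give
  all products in one identity a common range of summation, as associativity and distributivity
  require.\<close>

lemma monoid_algebra_mult_eq:
  assumes "finite A" "finite B" "{x. f x \<noteq> 0} \<subseteq> A" "{y. g y \<noteq> 0} \<subseteq> B"
  shows "(f \<otimes>\<^bsub>monoid_algebra G\<^esub> g) z = (\<Sum>x\<in>A. \<Sum>y\<in>B. if x \<otimes>\<^bsub>G\<^esub> y = z then f x * g y else 0)"
proof -
  have "(\<Sum>y | g y \<noteq> 0. if x \<otimes>\<^bsub>G\<^esub> y = z then f x * g y else 0) =
        (\<Sum>y\<in>B. if x \<otimes>\<^bsub>G\<^esub> y = z then f x * g y else 0)" for x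
    by (rule sum.mono_neutral_left) (use assms in auto)
  moreover have "(\<Sum>x | f x \<noteq> 0. \<Sum>y\<in>B. if x \<otimes>\<^bsub>G\<^esub> y = z then f x * g y else 0) =
        (\<Sum>x\<in>A. \<Sum>y\<in>B. if x \<otimes>\<^bsub>G\<^esub> y = z then f x * g y else 0)"
    by (rule sum.mono_neutral_left) (use assms in \<open>auto intro!: sum.neutral split: if_splits\<close>)
  ultimately show ?thesis
    by (simp add: monoid_algebra_def)
qed

lemma monoid_algebra_carrier:
  "f \<in> carrier (monoid_algebra G) \<longleftrightarrow> finite {x. f x \<noteq> 0} \<and> {x. f x \<noteq> 0} \<subseteq> carrier G"
  by (simp add: monoid_algebra_def)

lemma monoid_algebra_add: "f \<oplus>\<^bsub>monoid_algebra G\<^esub> g = (\<lambda>z. f z + g z)"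
  by (simp add: monoid_algebra_def)

lemma ma_term_mult:
  "ma_term a g \<otimes>\<^bsub>monoid_algebra G\<^esub> ma_term b h = ma_term (a * b) (g \<otimes>\<^bsub>G\<^esub> h)"
proof
  fix z
  show "(ma_term a g \<otimes>\<^bsub>monoid_algebra G\<^esub> ma_term b h) z = ma_term (a * b) (g \<otimes>\<^bsub>G\<^esub> h) z"
    by (subst monoid_algebra_mult_eq[of "{g}" "{h}"]) (auto simp: ma_term_def)
qed

lemma ma_term_closed [simp]: "g \<in> carrier G \<Longrightarrow> ma_term a g \<in> carrier (monoid_algebra G)"
  by (auto simp: monoid_algebra_carrier ma_term_def intro: finite_subset[of _ "{g}"])

text \<open>Besides closure under multiplication, this supplies the finite set over which a product
  is summed when it is multiplied again.\<close>

lemma monoid_algebra_supp_mult: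
  assumes "finite {x. f x \<noteq> 0}" "finite {y. g y \<noteq> 0}"
  shows "{z. (f \<otimes>\<^bsub>monoid_algebra G\<^esub> g) z \<noteq> 0} \<subseteq>
    (\<lambda>(x, y). x \<otimes>\<^bsub>G\<^esub> y) ` ({x. f x \<noteq> 0} \<times> {y. g y \<noteq> 0})"
proof
  fix z assume "z \<in> {z. (f \<otimes>\<^bsub>monoid_algebra G\<^esub> g) z \<noteq> 0}"
  then have "(\<Sum>x | f x \<noteq> 0. \<Sum>y | g y \<noteq> 0. if x \<otimes>\<^bsub>G\<^esub> y = z then f x * g y else 0) \<noteq> 0"
    by (simp add: monoid_algebra_def)
  then obtain x y where "f x \<noteq> 0" "g y \<noteq> 0" "x \<otimes>\<^bsub>G\<^esub> y = z"
    by (elim sum.not_neutral_contains_not_neutral) (auto split: if_splits)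
  then show "z \<in> (\<lambda>(x, y). x \<otimes>\<^bsub>G\<^esub> y) ` ({x. f x \<noteq> 0} \<times> {y. g y \<noteq> 0})"
    by force
qed

lemma (in monoid) monoid_algebra_ring: "ring (monoid_algebra G)"
proof (rule ringI)
  let ?M = "monoid_algebra G"
  show "abelian_group ?M"
  proof (rule abelian_groupI)
    fix f g assume "f \<in> carrier ?M" "g \<in> carrier ?M"
    moreover have "{x. f x + g x \<noteq> 0} \<subseteq> {x. f x \<noteq> 0} \<union> {x. g x \<noteq> 0}"
      by auto
    ultimately show "f \<oplus>\<^bsub>?M\<^esub> g \<in> carrier ?M"
      unfolding monoid_algebra_carrier monoid_algebra_add by (blast intro: finite_subset)
  next
    fix f assume "f \<in> carrier ?M"
    then show "\<exists>g\<in>carrier ?M. g \<oplus>\<^bsub>?M\<^esub> f = \<zero>\<^bsub>?M\<^esub>"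
      by (intro bexI[of _ "\<lambda>z. - f z"]) (auto simp: monoid_algebra_def)
  qed (auto simp: monoid_algebra_def add_ac)
  have closed: "f \<otimes>\<^bsub>?M\<^esub> g \<in> carrier ?M" if "f \<in> carrier ?M" "g \<in> carrier ?M" for f g
  proof -
    let ?P = "(\<lambda>(x, y). x \<otimes> y) ` ({x. f x \<noteq> 0} \<times> {y. g y \<noteq> 0})"
    have "finite ?P" "?P \<subseteq> carrier G" "{z. (f \<otimes>\<^bsub>?M\<^esub> g) z \<noteq> 0} \<subseteq> ?P"
      using that monoid_algebra_supp_mult[of f g] by (auto simp: monoid_algebra_carrier)
    then show ?thesis
      unfolding monoid_algebra_carrier by (blast intro: finite_subset)
  qed
  show "Group.monoid ?M"
  proof (rule Group.monoidI)
    show "\<one>\<^bsub>?M\<^esub> \<in> carrier ?M"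
      by (simp add: monoid_algebra_def)
  next
    fix f assume f: "f \<in> carrier ?M"
    define A where "A = {x. f x \<noteq> 0}"
    have A: "finite A" "A \<subseteq> carrier G" "{x. f x \<noteq> 0} \<subseteq> A"
      using f by (auto simp: A_def monoid_algebra_carrier)
    have one: "{x. \<one>\<^bsub>?M\<^esub> x \<noteq> 0} \<subseteq> {\<one>}" "\<one>\<^bsub>?M\<^esub> \<one> = 1"
      by (auto simp: monoid_algebra_def split: if_splits)
    show "\<one>\<^bsub>?M\<^esub> \<otimes>\<^bsub>?M\<^esub> f = f"
    proof
      fix z
      have "(\<one>\<^bsub>?M\<^esub> \<otimes>\<^bsub>?M\<^esub> f) z = (\<Sum>y\<in>A. if \<one> \<otimes> y = z then f y else 0)"
        by (subst monoid_algebra_mult_eq[OF _ A(1) one(1) A(3)]) (auto simp: one intro!: sum.cong)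
      also have "\<dots> = (\<Sum>y\<in>A. if y = z then f y else 0)"
        by (intro sum.cong) (use A in auto)
      also have "\<dots> = f z"
        using A by auto
      finally show "(\<one>\<^bsub>?M\<^esub> \<otimes>\<^bsub>?M\<^esub> f) z = f z" .
    qed
    show "f \<otimes>\<^bsub>?M\<^esub> \<one>\<^bsub>?M\<^esub> = f"
    proof
      fix z
      have "(f \<otimes>\<^bsub>?M\<^esub> \<one>\<^bsub>?M\<^esub>) z = (\<Sum>y\<in>A. if y \<otimes> \<one> = z then f y else 0)"
        by (subst monoid_algebra_mult_eq[OF A(1) _ A(3) one(1)]) (auto simp: one intro!: sum.cong)
      also have "\<dots> = (\<Sum>y\<in>A. if y = z then f y else 0)"
        by (intro sum.cong) (use A in auto)
      also have "\<dots> = f z"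
        using A by auto
      finally show "(f \<otimes>\<^bsub>?M\<^esub> \<one>\<^bsub>?M\<^esub>) z = f z" .
    qed
  next
    fix f g h assume fgh: "f \<in> carrier ?M" "g \<in> carrier ?M" "h \<in> carrier ?M"
    define A B C where "A = {x. f x \<noteq> 0}" and "B = {x. g x \<noteq> 0}" and "C = {x. h x \<noteq> 0}"
    have fin: "finite A" "finite B" "finite C" and carr: "A \<subseteq> carrier G" "B \<subseteq> carrier G" "C \<subseteq> carrier G"
      using fgh by (auto simp: A_def B_def C_def monoid_algebra_carrier)
    have sub: "{x. f x \<noteq> 0} \<subseteq> A" "{x. g x \<noteq> 0} \<subseteq> B" "{x. h x \<noteq> 0} \<subseteq> C"
      by (auto simp: A_def B_def C_def)
    define P where "P = (\<lambda>(x, y). x \<otimes> y) ` (A \<times> B)"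
    define Q where "Q = (\<lambda>(x, y). x \<otimes> y) ` (B \<times> C)"
    have P: "finite P" "{z. (f \<otimes>\<^bsub>?M\<^esub> g) z \<noteq> 0} \<subseteq> P" and Q: "finite Q" "{z. (g \<otimes>\<^bsub>?M\<^esub> h) z \<noteq> 0} \<subseteq> Q"
      using fin monoid_algebra_supp_mult[of f g G] monoid_algebra_supp_mult[of g h G]
      by (auto simp: P_def Q_def A_def B_def C_def)
    show "f \<otimes>\<^bsub>?M\<^esub> g \<otimes>\<^bsub>?M\<^esub> h = f \<otimes>\<^bsub>?M\<^esub> (g \<otimes>\<^bsub>?M\<^esub> h)"
    proof
      fix z
      let ?S = "\<Sum>x\<in>A. \<Sum>y\<in>B. \<Sum>w\<in>C. if x \<otimes> y \<otimes> w = z then f x * g y * h w else 0"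
      have "((f \<otimes>\<^bsub>?M\<^esub> g) \<otimes>\<^bsub>?M\<^esub> h) z =
          (\<Sum>u\<in>P. \<Sum>w\<in>C. if u \<otimes> w = z then (f \<otimes>\<^bsub>?M\<^esub> g) u * h w else 0)"
        by (rule monoid_algebra_mult_eq[OF P(1) fin(3) P(2) sub(3)])
      also have "\<dots> = (\<Sum>u\<in>P. \<Sum>w\<in>C. \<Sum>x\<in>A. \<Sum>y\<in>B.
          if x \<otimes> y = u then if u \<otimes> w = z then f x * g y * h w else 0 else 0)"
        by (intro sum.cong refl, subst monoid_algebra_mult_eq[OF fin(1,2) sub(1,2)])
          (auto simp: sum_distrib_right intro!: sum.cong sum.neutral)
      also have "\<dots> = (\<Sum>w\<in>C. \<Sum>x\<in>A. \<Sum>y\<in>B. \<Sum>u\<in>P.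
          if x \<otimes> y = u then if u \<otimes> w = z then f x * g y * h w else 0 else 0)"
        by (subst sum.swap, rule sum.cong[OF refl], subst sum.swap, rule sum.cong[OF refl], rule sum.swap)
      \<comment> \<open>For fixed \<open>x\<close> and \<open>y\<close> only
        \<open>u = x \<otimes> y\<close> contributes, and it lies in \<open>P\<close> by the choice
        of \<open>P\<close>.\<close>
      also have "\<dots> = (\<Sum>w\<in>C. \<Sum>x\<in>A. \<Sum>y\<in>B. if x \<otimes> y \<otimes> w = z then f x * g y * h w else 0)"
        using P(1) by (intro sum.cong refl) (auto simp: P_def)
      also have "\<dots> = ?S"
        by (subst sum.swap, rule sum.cong[OF refl], rule sum.swap)
      finally have 1: "((f \<otimes>\<^bsub>?M\<^esub> g) \<otimes>\<^bsub>?M\<^esub> h) z = ?S" .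
      have "(f \<otimes>\<^bsub>?M\<^esub> (g \<otimes>\<^bsub>?M\<^esub> h)) z =
          (\<Sum>x\<in>A. \<Sum>u\<in>Q. if x \<otimes> u = z then f x * (g \<otimes>\<^bsub>?M\<^esub> h) u else 0)"
        by (rule monoid_algebra_mult_eq[OF fin(1) Q(1) sub(1) Q(2)])
      also have "\<dots> = (\<Sum>x\<in>A. \<Sum>u\<in>Q. \<Sum>y\<in>B. \<Sum>w\<in>C.
          if y \<otimes> w = u then if x \<otimes> u = z then f x * g y * h w else 0 else 0)"
        by (intro sum.cong refl, subst monoid_algebra_mult_eq[OF fin(2,3) sub(2,3)])
          (auto simp: sum_distrib_left mult.assoc intro!: sum.cong sum.neutral)
      also have "\<dots> = (\<Sum>x\<in>A. \<Sum>y\<in>B. \<Sum>w\<in>C. \<Sum>u\<in>Q.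
          if y \<otimes> w = u then if x \<otimes> u = z then f x * g y * h w else 0 else 0)"
        by (rule sum.cong[OF refl], subst sum.swap, rule sum.cong[OF refl], rule sum.swap)
      also have "\<dots> = (\<Sum>x\<in>A. \<Sum>y\<in>B. \<Sum>w\<in>C. if x \<otimes> (y \<otimes> w) = z then f x * g y * h w else 0)"
        using Q(1) by (intro sum.cong refl) (auto simp: Q_def)
      also have "\<dots> = ?S"
        using carr by (intro sum.cong refl) (auto simp: m_assoc subset_iff)
      finally show "((f \<otimes>\<^bsub>?M\<^esub> g) \<otimes>\<^bsub>?M\<^esub> h) z = (f \<otimes>\<^bsub>?M\<^esub> (g \<otimes>\<^bsub>?M\<^esub> h)) z"
        using 1 by simp
    qed
  qed (rule closed)
  have add_distrib: "(\<lambda>z. f z + g z) \<otimes>\<^bsub>?M\<^esub> h = (\<lambda>z. (f \<otimes>\<^bsub>?M\<^esub> h) z + (g \<otimes>\<^bsub>?M\<^esub> h) z)"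
    "h \<otimes>\<^bsub>?M\<^esub> (\<lambda>z. f z + g z) = (\<lambda>z. (h \<otimes>\<^bsub>?M\<^esub> f) z + (h \<otimes>\<^bsub>?M\<^esub> g) z)"
    if "f \<in> carrier ?M" "g \<in> carrier ?M" "h \<in> carrier ?M" for f g h
  proof -
    \<comment> \<open>The union of both supports is the common index set; cancellation can shrink
      the support of the sum.\<close>
    define A where "A = {x. f x \<noteq> 0} \<union> {x. g x \<noteq> 0}"
    define C where "C = {x. h x \<noteq> 0}"
    have fin: "finite A" "finite C"
      using that by (auto simp: A_def C_def monoid_algebra_carrier)
    have sub: "{x. f x \<noteq> 0} \<subseteq> A" "{x. g x \<noteq> 0} \<subseteq> A" "{x. f x + g x \<noteq> 0} \<subseteq> A" "{x. h x \<noteq> 0} \<subseteq> C"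
      by (auto simp: A_def C_def)
    show "(\<lambda>z. f z + g z) \<otimes>\<^bsub>?M\<^esub> h = (\<lambda>z. (f \<otimes>\<^bsub>?M\<^esub> h) z + (g \<otimes>\<^bsub>?M\<^esub> h) z)"
      unfolding monoid_algebra_mult_eq[OF fin sub(1,4)] monoid_algebra_mult_eq[OF fin sub(2,4)]
        monoid_algebra_mult_eq[OF fin sub(3,4)] sum.distrib[symmetric]
      by (intro ext sum.cong refl) (auto simp: algebra_simps)
    show "h \<otimes>\<^bsub>?M\<^esub> (\<lambda>z. f z + g z) = (\<lambda>z. (h \<otimes>\<^bsub>?M\<^esub> f) z + (h \<otimes>\<^bsub>?M\<^esub> g) z)"
      unfolding monoid_algebra_mult_eq[OF fin(2,1) sub(4,1)] monoid_algebra_mult_eq[OF fin(2,1) sub(4,2)]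
        monoid_algebra_mult_eq[OF fin(2,1) sub(4,3)] sum.distrib[symmetric]
      by (intro ext sum.cong refl) (auto simp: algebra_simps)
  qed
  fix f g h assume "f \<in> carrier ?M" "g \<in> carrier ?M" "h \<in> carrier ?M"
  then show "(f \<oplus>\<^bsub>?M\<^esub> g) \<otimes>\<^bsub>?M\<^esub> h = f \<otimes>\<^bsub>?M\<^esub> h \<oplus>\<^bsub>?M\<^esub> g \<otimes>\<^bsub>?M\<^esub> h"
    "h \<otimes>\<^bsub>?M\<^esub> (f \<oplus>\<^bsub>?M\<^esub> g) = h \<otimes>\<^bsub>?M\<^esub> f \<oplus>\<^bsub>?M\<^esub> h \<otimes>\<^bsub>?M\<^esub> g"
    by (simp_all add: add_distrib monoid_algebra_add)
qed

subsection \<open>Smooth vector fields\<close>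

text \<open>On an open set, equality on \<open>S\<close> is equality near each point, so the
  derivatives agree on \<open>S\<close> too. The inductions below rely on this: the sum and product
  rules identify a derivative only on \<open>S\<close>, while the recursive definition speaks of the
  whole function.\<close>

lemma differentiable_times_on_cong:
  assumes "open S" "\<And>p. p \<in> S \<Longrightarrow> X p = Y p" "differentiable_times_on k S X"
  shows "differentiable_times_on k S Y"
  using assms(2,3)
proof (induction k arbitrary: X Y)
  case 0
  then show ?case
    using continuous_on_cong by force
next
  case (Suc k)
  have X: "X differentiable at p" if "p \<in> S" for p
    using Suc.prems that by simp
  have Y: "Y differentiable at p" if "p \<in> S" for p
    using X[OF that] has_derivative_transform_within_open[of X _ p UNIV S Y] \<open>open S\<close> that Suc.prems(1)
    unfolding differentiable_def by blast
  have "frechet_derivative X (at p) v = frechet_derivative Y (at p) v" if "p \<in> S" for p v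
    using frechet_derivative_transform_within_open[OF X[OF that] \<open>open S\<close> that Suc.prems(1)] by simp
  then show ?case
    using Y Suc.IH[of "\<lambda>p. frechet_derivative X (at p) v" "\<lambda>p. frechet_derivative Y (at p) v" for v]
      Suc.prems(2) by simp
qed

lemma differentiable_times_on_subset:
  "T \<subseteq> S \<Longrightarrow> differentiable_times_on k S X \<Longrightarrow> differentiable_times_on k T X"
  by (induction k arbitrary: X) (auto intro: continuous_on_subset)

text \<open>The product rule leaves one factor undifferentiated, and that factor must be usable at
  the lower order.\<close>

lemma differentiable_times_on_Suc_imp:
  "differentiable_times_on (Suc k) S X \<Longrightarrow> differentiable_times_on k S X"
proof (induction k arbitrary: X)
  case 0
  then show ?case
    by (auto intro!: continuous_at_imp_continuous_on differentiable_imp_continuous_within)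
next
  case (Suc k)
  then show ?case
    by (metis differentiable_times_on.simps(2))
qed

lemma differentiable_times_on_const: "differentiable_times_on k S (\<lambda>_. c)"
  by (induction k arbitrary: c) (auto simp: frechet_derivative_const)

lemma differentiable_times_on_add:
  assumes "open S" "differentiable_times_on k S X" "differentiable_times_on k S Y"
  shows "differentiable_times_on k S (\<lambda>p. X p + Y p)"
  using assms(2,3)
proof (induction k arbitrary: X Y)
  case 0
  then show ?case
    by (auto intro: continuous_on_add)
next
  case (Suc k)
  have D: "((\<lambda>p. X p + Y p) has_derivative
      (\<lambda>v. frechet_derivative X (at p) v + frechet_derivative Y (at p) v)) (at p)" if "p \<in> S" for p
    using Suc.prems that by (intro has_derivative_add) (auto simp: frechet_derivative_works[symmetric])
  have E: "frechet_derivative (\<lambda>p. X p + Y p) (at p) v =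
      frechet_derivative X (at p) v + frechet_derivative Y (at p) v" if "p \<in> S" for p v
    by (simp add: frechet_derivative_at[symmetric, OF D[OF that]])
  have "differentiable_times_on k S (\<lambda>p. frechet_derivative X (at p) v + frechet_derivative Y (at p) v)" for v
    using Suc.prems by (intro Suc.IH) auto
  then have "differentiable_times_on k S (\<lambda>p. frechet_derivative (\<lambda>p. X p + Y p) (at p) v)" for v
    by (rule differentiable_times_on_cong[OF \<open>open S\<close>, rotated]) (simp add: E)
  moreover have "(\<lambda>p. X p + Y p) differentiable at p" if "p \<in> S" for p
    using D[OF that] by (auto simp: differentiable_def)
  ultimately show ?case
    by simp
qed

lemma differentiable_times_on_bounded_linear:
  assumes "open S" "bounded_linear L" "differentiable_times_on k S X"
  shows "differentiable_times_on k S (\<lambda>p. L (X p))"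
  using assms(3)
proof (induction k arbitrary: X)
  case 0
  then show ?case
    using assms(2) by (auto intro: bounded_linear.continuous_on)
next
  case (Suc k)
  have D: "((\<lambda>p. L (X p)) has_derivative (\<lambda>v. L (frechet_derivative X (at p) v))) (at p)" if "p \<in> S" for p
    using Suc.prems that
    by (intro bounded_linear.has_derivative[OF assms(2)]) (auto simp: frechet_derivative_works[symmetric])
  have E: "frechet_derivative (\<lambda>p. L (X p)) (at p) v = L (frechet_derivative X (at p) v)" if "p \<in> S" for p v
    by (simp add: frechet_derivative_at[symmetric, OF D[OF that]])
  have "differentiable_times_on k S (\<lambda>p. L (frechet_derivative X (at p) v))" for v
    using Suc.prems by (intro Suc.IH) auto
  then have "differentiable_times_on k S (\<lambda>p. frechet_derivative (\<lambda>p. L (X p)) (at p) v)" for v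
    by (rule differentiable_times_on_cong[OF \<open>open S\<close>, rotated]) (simp add: E)
  moreover have "(\<lambda>p. L (X p)) differentiable at p" if "p \<in> S" for p
    using D[OF that] by (auto simp: differentiable_def)
  ultimately show ?case
    by simp
qed

lemma differentiable_times_on_scaleR:
  fixes f :: "'a::euclidean_space \<Rightarrow> real" and X :: "'a \<Rightarrow> 'b::euclidean_space"
  assumes "open S" "differentiable_times_on k S f" "differentiable_times_on k S X"
  shows "differentiable_times_on k S (\<lambda>p. f p *\<^sub>R X p)"
  using assms(2,3)
proof (induction k arbitrary: f X)
  case 0
  then show ?case
    by (auto intro: continuous_on_scaleR)
next
  case (Suc k)
  have D: "((\<lambda>p. f p *\<^sub>R X p) has_derivative
      (\<lambda>v. f p *\<^sub>R frechet_derivative X (at p) v + frechet_derivative f (at p) v *\<^sub>R X p)) (at p)"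
    if "p \<in> S" for p
    using Suc.prems that
    by (intro has_derivative_scaleR) (auto simp: frechet_derivative_works[symmetric])
  have E: "frechet_derivative (\<lambda>p. f p *\<^sub>R X p) (at p) v =
      f p *\<^sub>R frechet_derivative X (at p) v + frechet_derivative f (at p) v *\<^sub>R X p" if "p \<in> S" for p v
    by (simp add: frechet_derivative_at[symmetric, OF D[OF that]])
  have "differentiable_times_on k S (\<lambda>p. f p *\<^sub>R frechet_derivative X (at p) v
      + frechet_derivative f (at p) v *\<^sub>R X p)" for v
    using Suc.prems Suc.prems[THEN differentiable_times_on_Suc_imp]
    by (intro differentiable_times_on_add[OF \<open>open S\<close>] Suc.IH) auto
  then have "differentiable_times_on k S (\<lambda>p. frechet_derivative (\<lambda>p. f p *\<^sub>R X p) (at p) v)" for v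
    by (rule differentiable_times_on_cong[OF \<open>open S\<close>, rotated]) (simp add: E)
  moreover have "(\<lambda>p. f p *\<^sub>R X p) differentiable at p" if "p \<in> S" for p
    using D[OF that] by (auto simp: differentiable_def)
  ultimately show ?case
    by simp
qed

lemma smooth_on_cong:
  "open S \<Longrightarrow> (\<And>p. p \<in> S \<Longrightarrow> X p = Y p) \<Longrightarrow> smooth_on S X \<Longrightarrow> smooth_on S Y"
  unfolding smooth_on_def using differentiable_times_on_cong by blast

lemma smooth_on_subset: "T \<subseteq> S \<Longrightarrow> smooth_on S X \<Longrightarrow> smooth_on T X"
  unfolding smooth_on_def using differentiable_times_on_subset by blast

lemma smooth_on_const: "smooth_on S (\<lambda>_. c)"
  by (simp add: smooth_on_def differentiable_times_on_const)

lemma smooth_on_add: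
  "open S \<Longrightarrow> smooth_on S X \<Longrightarrow> smooth_on S Y \<Longrightarrow> smooth_on S (\<lambda>p. X p + Y p)"
  by (simp add: smooth_on_def differentiable_times_on_add)

lemma smooth_on_compose_bounded_linear:
  "open S \<Longrightarrow> bounded_linear L \<Longrightarrow> smooth_on S X \<Longrightarrow> smooth_on S (\<lambda>p. L (X p))"
  by (simp add: smooth_on_def differentiable_times_on_bounded_linear)

lemma smooth_on_scaleR:
  fixes f :: "'a::euclidean_space \<Rightarrow> real"
  shows "open S \<Longrightarrow> smooth_on S f \<Longrightarrow> smooth_on S X \<Longrightarrow> smooth_on S (\<lambda>p. f p *\<^sub>R X p)"
  by (simp add: smooth_on_def differentiable_times_on_scaleR)

lemma smooth_on_sum:
  "open S \<Longrightarrow> (\<And>b. b \<in> B \<Longrightarrow> smooth_on S (X b)) \<Longrightarrow> smooth_on S (\<lambda>p. \<Sum>b\<in>B. X b p)"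
  by (induction B rule: infinite_finite_induct) (simp_all add: smooth_on_const smooth_on_add)

lemma smooth_on_frechet_derivative:
  "smooth_on S X \<Longrightarrow> smooth_on S (\<lambda>p. frechet_derivative X (at p) v)"
  by (metis differentiable_times_on.simps(2) smooth_on_def)

lemma smooth_on_imp_differentiable: "smooth_on S X \<Longrightarrow> p \<in> S \<Longrightarrow> X differentiable at p"
  by (metis differentiable_times_on.simps(2) smooth_on_def)

lemma smooth_on_bounded_linear:
  assumes "open S" "bounded_linear L"
  shows "smooth_on S L"
proof -
  have "differentiable_times_on k S L" for k
    by (cases k) (auto simp: assms bounded_linear.linear linear_continuous_on
        bounded_linear_imp_differentiable frechet_derivative_at[symmetric, OF bounded_linear_imp_has_derivative]
        differentiable_times_on_const)
  then show ?thesis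
    by (simp add: smooth_on_def)
qed

section \<open>The Lie algebra of smooth vector fields and commuting pairs\<close>

lemma zero_in_vfields: "(\<lambda>_. 0) \<in> vfields S"
  by (simp add: vfields_def smooth_on_const)

lemma add_in_vfields:
  "open S \<Longrightarrow> X \<in> vfields S \<Longrightarrow> Y \<in> vfields S \<Longrightarrow> (\<lambda>p. X p + Y p) \<in> vfields S"
  by (simp add: vfields_def smooth_on_add)

lemma scaleR_in_vfields:
  "open S \<Longrightarrow> X \<in> vfields S \<Longrightarrow> (\<lambda>p. a *\<^sub>R X p) \<in> vfields S"
  by (simp add: vfields_def smooth_on_scaleR smooth_on_const)

text \<open>Smoothness is phrased with derivatives along fixed vectors, whereas the bracket
  differentiates along the varying vector \<open>X p\<close>. Expanding \<open>X p\<close> in the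
  standard basis gives a finite sum of smooth coefficients times derivatives in fixed
  directions.\<close>

lemma lie_bracket_in_vfields:
  assumes "open S" "X \<in> vfields S" "Y \<in> vfields S"
  shows "lie_bracket S X Y \<in> vfields S"
proof -
  have *: "smooth_on S (\<lambda>p. frechet_derivative Y (at p) (X p))" if "smooth_on S X" "smooth_on S Y"
    for X Y :: vfield
  proof (rule smooth_on_cong[OF assms(1)])
    show "smooth_on S (\<lambda>p. \<Sum>b\<in>Basis. (X p \<bullet> b) *\<^sub>R frechet_derivative Y (at p) b)"
      using that by (intro smooth_on_sum smooth_on_scaleR smooth_on_frechet_derivative assms(1)
          smooth_on_compose_bounded_linear[OF _ bounded_linear_inner_left])
    fix p assume "p \<in> S"
    then have "linear (frechet_derivative Y (at p))"
      using smooth_on_imp_differentiable[OF that(2)] linear_frechet_derivative by blast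
    then have "(\<Sum>b\<in>Basis. (X p \<bullet> b) *\<^sub>R frechet_derivative Y (at p) b) =
        frechet_derivative Y (at p) (\<Sum>b\<in>Basis. (X p \<bullet> b) *\<^sub>R b)"
      by (simp add: linear_sum linear_cmul)
    then show "(\<Sum>b\<in>Basis. (X p \<bullet> b) *\<^sub>R frechet_derivative Y (at p) b) = frechet_derivative Y (at p) (X p)"
      by (simp add: euclidean_representation)
  qed
  have "smooth_on S (\<lambda>p. frechet_derivative Y (at p) (X p) + (-1) *\<^sub>R frechet_derivative X (at p) (Y p))"
    using assms by (intro smooth_on_add smooth_on_scaleR smooth_on_const *) (auto simp: vfields_def)
  then have "smooth_on S (lie_bracket S X Y)"
    by (rule smooth_on_cong[OF assms(1), rotated]) (simp add: lie_bracket_def)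
  then show ?thesis
    by (simp add: vfields_def lie_bracket_def)
qed

lemma lie_bracket_add_scaleR_left:
  assumes "X \<in> vfields S" "Y \<in> vfields S" "Z \<in> vfields S"
  shows "lie_bracket S (\<lambda>p. X p + a *\<^sub>R Y p) Z = (\<lambda>p. lie_bracket S X Z p + a *\<^sub>R lie_bracket S Y Z p)"
proof
  fix p
  show "lie_bracket S (\<lambda>p. X p + a *\<^sub>R Y p) Z p = lie_bracket S X Z p + a *\<^sub>R lie_bracket S Y Z p"
  proof (cases "p \<in> S")
    case True
    then have d: "X differentiable at p" "Y differentiable at p" "Z differentiable at p"
      using assms smooth_on_imp_differentiable by (auto simp: vfields_def)
    have "((\<lambda>p. X p + a *\<^sub>R Y p) has_derivative
        (\<lambda>v. frechet_derivative X (at p) v + a *\<^sub>R frechet_derivative Y (at p) v)) (at p)"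
      using d by (intro derivative_intros) (simp_all add: frechet_derivative_works[symmetric])
    then have 1: "frechet_derivative (\<lambda>p. X p + a *\<^sub>R Y p) (at p) =
        (\<lambda>v. frechet_derivative X (at p) v + a *\<^sub>R frechet_derivative Y (at p) v)"
      by (rule frechet_derivative_at[symmetric])
    show ?thesis
      using True linear_frechet_derivative[OF d(3)]
      by (simp add: lie_bracket_def 1 linear_add linear_cmul algebra_simps)
  qed (simp add: lie_bracket_def)
qed

lemma lie_bracket_skew: "lie_bracket S X Y = (\<lambda>p. - lie_bracket S Y X p)"
  by (auto simp: lie_bracket_def)

lemma commuting_fields_add:
  assumes "open S" "commuting_fields S X Y"
  shows "commuting_fields S (\<lambda>p. X p + a *\<^sub>R Y p) Y"
proof -
  have "lie_bracket S Y Y = (\<lambda>_. 0)"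
    by (auto simp: lie_bracket_def)
  then show ?thesis
    using assms by (simp add: commuting_fields_def lie_bracket_add_scaleR_left add_in_vfields scaleR_in_vfields)
qed

lemma lie_bracket_zero_right:
  assumes "X \<in> vfields S"
  shows "lie_bracket S X (\<lambda>_. 0) = (\<lambda>_. 0)"
proof
  fix p
  show "lie_bracket S X (\<lambda>_. 0) p = 0"
  proof (cases "p \<in> S")
    case True
    then have "linear (frechet_derivative X (at p))"
      using assms by (intro linear_frechet_derivative smooth_on_imp_differentiable) (auto simp: vfields_def)
    then show ?thesis
      using True by (simp add: lie_bracket_def frechet_derivative_const linear_0)
  qed (simp add: lie_bracket_def)
qed

lemma commuting_fields_zero: "X \<in> vfields S \<Longrightarrow> commuting_fields S X (\<lambda>_. 0)"
  by (simp add: commuting_fields_def zero_in_vfields lie_bracket_zero_right)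

lemma commuting_fields_swap:
  assumes "open S" "commuting_fields S X Y"
  shows "commuting_fields S Y (\<lambda>p. - X p)"
proof -
  have XY: "X \<in> vfields S" "Y \<in> vfields S" "lie_bracket S X Y = (\<lambda>_. 0)"
    using assms by (simp_all add: commuting_fields_def)
  have "lie_bracket S (\<lambda>_. 0) Y = (\<lambda>_. 0)"
    using lie_bracket_skew[of S "\<lambda>_. 0" Y] lie_bracket_zero_right[OF XY(2)] by simp
  then have "lie_bracket S (\<lambda>p. - X p) Y = (\<lambda>_. 0)"
    using lie_bracket_add_scaleR_left[OF zero_in_vfields XY(1,2), of "-1"] XY(3) by simp
  then have "lie_bracket S Y (\<lambda>p. - X p) = (\<lambda>_. 0)"
    by (subst lie_bracket_skew) simp
  then show ?thesis
    using XY scaleR_in_vfields[OF assms(1) XY(1), of "-1"] by (simp add: commuting_fields_def)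
qed

text \<open>Fields and brackets refer to a fixed open set, so passing to a smaller shell means
  cutting the fields off outside it. Inside, openness keeps the derivatives unchanged.\<close>

lemma commuting_fields_subset:
  assumes "open S" "open T" "T \<subseteq> S" "commuting_fields S X Y"
    and X': "X' = (\<lambda>p. if p \<in> T then X p else 0)" and Y': "Y' = (\<lambda>p. if p \<in> T then Y p else 0)"
  shows "commuting_fields T X' Y'"
proof -
  have smooth: "smooth_on S X" "smooth_on S Y"
    using assms by (auto simp: commuting_fields_def vfields_def)
  have "smooth_on T X'" "smooth_on T Y'"
    by (rule smooth_on_cong[OF assms(2) _ smooth_on_subset[OF assms(3) smooth(1)]], simp add: X')
      (rule smooth_on_cong[OF assms(2) _ smooth_on_subset[OF assms(3) smooth(2)]], simp add: Y')
  moreover have "lie_bracket T X' Y' p = 0" for p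
  proof (cases "p \<in> T")
    case True
    then have "p \<in> S"
      using assms by auto
    then have "X differentiable at p" "Y differentiable at p"
      using smooth smooth_on_imp_differentiable by auto
    then have "frechet_derivative X (at p) = frechet_derivative X' (at p)"
      "frechet_derivative Y (at p) = frechet_derivative Y' (at p)"
      by (auto intro!: frechet_derivative_transform_within_open[OF _ assms(2) True] simp: X' Y')
    moreover have "lie_bracket S X Y p = 0"
      using assms by (simp add: commuting_fields_def)
    ultimately show ?thesis
      using True \<open>p \<in> S\<close> by (simp add: lie_bracket_def X' Y')
  qed (simp add: lie_bracket_def)
  ultimately show ?thesis
    by (auto simp: commuting_fields_def vfields_def X' Y')
qed

subsection \<open>The enveloping algebra and the twist\<close>

text \<open>All defining identities of the presented algebras are read off in this way: the
  difference of the two sides is one of the generating relations.\<close>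

lemma Idl_coset_eq:
  assumes "ring M" "R \<subseteq> carrier M" "a \<in> carrier M" "b \<in> carrier M" "a \<ominus>\<^bsub>M\<^esub> b \<in> R"
  shows "Idl\<^bsub>M\<^esub> R +>\<^bsub>M\<^esub> a = Idl\<^bsub>M\<^esub> R +>\<^bsub>M\<^esub> b"
  using assms ring.quotient_eq_iff_same_a_r_cos[of M "Idl\<^bsub>M\<^esub> R" a b] ring.genideal_ideal[of M R]
    ring.genideal_self[of M R] by blast

lemma words_carrier [simp]: "carrier (words A) = lists A"
  by (simp add: words_def)

lemma words_mult [simp]: "u \<otimes>\<^bsub>words A\<^esub> v = u @ v"
  by (simp add: words_def)

lemma words_monoid: "Group.monoid (words A)"
  by (rule Group.monoidI) (auto simp: words_def)

lemma free_alg_ring: "ring (free_alg S)"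
  by (rule monoid.monoid_algebra_ring[OF words_monoid])

lemma env_relations_subset:
  assumes "open S"
  shows "env_relations S \<subseteq> carrier (free_alg S)"
proof -
  interpret ring "free_alg S"
    by (rule free_alg_ring)
  show ?thesis
    unfolding env_relations_def
    by (auto intro!: minus_closed add.m_closed ma_term_closed add_in_vfields scaleR_in_vfields
        lie_bracket_in_vfields assms)
qed

lemma env_ideal_ideal: "open S \<Longrightarrow> ideal (env_ideal S) (free_alg S)"
  unfolding env_ideal_def by (intro ring.genideal_ideal free_alg_ring env_relations_subset)

lemma env_alg_ring: "open S \<Longrightarrow> ring (env_alg S)"
  unfolding env_alg_def by (rule ideal.quotient_is_ring[OF env_ideal_ideal])

lemma env_alg_hom:
  "open S \<Longrightarrow> (\<lambda>f. env_ideal S +>\<^bsub>free_alg S\<^esub> f) \<in> ring_hom (free_alg S) (env_alg S)"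
  unfolding env_alg_def by (rule ideal.rcos_ring_hom[OF env_ideal_ideal])

lemma env_incl_closed: "open S \<Longrightarrow> X \<in> vfields S \<Longrightarrow> env_incl S X \<in> carrier (env_alg S)"
  unfolding env_incl_def by (rule ring_hom_closed[OF env_alg_hom]) auto

lemma env_scalar_closed: "open S \<Longrightarrow> env_scalar S a \<in> carrier (env_alg S)"
  unfolding env_scalar_def by (rule ring_hom_closed[OF env_alg_hom]) auto

lemma env_incl_add:
  assumes "open S" "X \<in> vfields S" "Y \<in> vfields S"
  shows "env_incl S (\<lambda>p. X p + Y p) = env_incl S X \<oplus>\<^bsub>env_alg S\<^esub> env_incl S Y"
proof -
  interpret ring "free_alg S"
    by (rule free_alg_ring)
  have "env_incl S (\<lambda>p. X p + Y p) =
      env_ideal S +>\<^bsub>free_alg S\<^esub> (ma_term 1 [X] \<oplus>\<^bsub>free_alg S\<^esub> ma_term 1 [Y])"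
    unfolding env_incl_def env_ideal_def
    by (rule Idl_coset_eq[OF free_alg_ring env_relations_subset])
      (use assms in \<open>auto simp: env_relations_def intro!: add.m_closed ma_term_closed add_in_vfields\<close>)
  also have "\<dots> = env_incl S X \<oplus>\<^bsub>env_alg S\<^esub> env_incl S Y"
    unfolding env_incl_def using assms by (intro ring_hom_add[OF env_alg_hom]) auto
  finally show ?thesis .
qed

text \<open>The relation only yields \<open>ma_term a [X]\<close>. Splitting it as empty word times
  generator puts the scalar into the form that the tensor relations can move from one factor to the
  other.\<close>

lemma env_incl_scaleR:
  assumes "open S" "X \<in> vfields S"
  shows "env_incl S (\<lambda>p. a *\<^sub>R X p) = env_scalar S (complex_of_real a) \<otimes>\<^bsub>env_alg S\<^esub> env_incl S X"
proof -
  have "env_incl S (\<lambda>p. a *\<^sub>R X p) = env_ideal S +>\<^bsub>free_alg S\<^esub> ma_term (complex_of_real a) [X]"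
    unfolding env_incl_def env_ideal_def
    by (rule Idl_coset_eq[OF free_alg_ring env_relations_subset])
      (use assms in \<open>auto simp: env_relations_def intro!: ma_term_closed scaleR_in_vfields\<close>)
  also have "\<dots> = env_ideal S +>\<^bsub>free_alg S\<^esub>
      (ma_term (complex_of_real a) [] \<otimes>\<^bsub>free_alg S\<^esub> ma_term 1 [X])"
    by (simp add: ma_term_mult)
  also have "\<dots> = env_scalar S (complex_of_real a) \<otimes>\<^bsub>env_alg S\<^esub> env_incl S X"
    unfolding env_incl_def env_scalar_def using assms by (intro ring_hom_mult[OF env_alg_hom]) auto
  finally show ?thesis .
qed

section \<open>The tensor square of the enveloping algebra\<close>

lemma tensor_square_ring:
  "open S \<Longrightarrow> ring (monoid_algebra (env_alg S \<times>\<times> env_alg S))"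
  by (intro monoid.monoid_algebra_ring DirProd_monoid ring.is_monoid env_alg_ring)

lemma tensor_relations_subset:
  assumes "open S"
  shows "tensor_relations (env_alg S) (env_scalar S) (env_alg S) (env_scalar S) \<subseteq>
    carrier (monoid_algebra (env_alg S \<times>\<times> env_alg S))"
proof -
  interpret M: ring "monoid_algebra (env_alg S \<times>\<times> env_alg S)"
    by (rule tensor_square_ring[OF assms])
  interpret E: ring "env_alg S"
    by (rule env_alg_ring[OF assms])
  show ?thesis
    unfolding tensor_relations_def Let_def
    by (auto intro!: M.minus_closed M.add.m_closed ma_term_closed E.add.m_closed E.m_closed
        env_scalar_closed[OF assms])
qed

lemma tensor_relations_memI:
  fixes A :: "'a ring" and B :: "'b ring"
  defines "M \<equiv> monoid_algebra (A \<times>\<times> B)"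
  shows "a \<in> carrier A \<Longrightarrow> a' \<in> carrier A \<Longrightarrow> b \<in> carrier B \<Longrightarrow>
      ma_term 1 (a \<oplus>\<^bsub>A\<^esub> a', b) \<ominus>\<^bsub>M\<^esub> (ma_term 1 (a, b) \<oplus>\<^bsub>M\<^esub> ma_term 1 (a', b)) \<in> tensor_relations A \<alpha> B \<beta>"
    and "a \<in> carrier A \<Longrightarrow> b \<in> carrier B \<Longrightarrow> b' \<in> carrier B \<Longrightarrow>
      ma_term 1 (a, b \<oplus>\<^bsub>B\<^esub> b') \<ominus>\<^bsub>M\<^esub> (ma_term 1 (a, b) \<oplus>\<^bsub>M\<^esub> ma_term 1 (a, b')) \<in> tensor_relations A \<alpha> B \<beta>"
    and "a \<in> carrier A \<Longrightarrow> b \<in> carrier B \<Longrightarrow>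
      ma_term 1 (\<alpha> s \<otimes>\<^bsub>A\<^esub> a, b) \<ominus>\<^bsub>M\<^esub> ma_term s (a, b) \<in> tensor_relations A \<alpha> B \<beta>"
    and "a \<in> carrier A \<Longrightarrow> b \<in> carrier B \<Longrightarrow>
      ma_term 1 (a, \<beta> s \<otimes>\<^bsub>B\<^esub> b) \<ominus>\<^bsub>M\<^esub> ma_term s (a, b) \<in> tensor_relations A \<alpha> B \<beta>"
  unfolding M_def tensor_relations_def Let_def by blast+

lemma UU_ring: "open S \<Longrightarrow> ring (UU S)"
  unfolding tensor_alg_def tensor_ideal_def
  by (intro ideal.quotient_is_ring ring.genideal_ideal tensor_square_ring tensor_relations_subset)

lemma UU_hom:
  "open S \<Longrightarrow> (\<lambda>f. tensor_ideal (env_alg S) (env_scalar S) (env_alg S) (env_scalar S)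
      +>\<^bsub>monoid_algebra (env_alg S \<times>\<times> env_alg S)\<^esub> f)
    \<in> ring_hom (monoid_algebra (env_alg S \<times>\<times> env_alg S)) (UU S)"
  unfolding tensor_alg_def tensor_ideal_def
  by (intro ideal.rcos_ring_hom ring.genideal_ideal tensor_square_ring tensor_relations_subset)

lemma UU_tensor_closed:
  "open S \<Longrightarrow> a \<in> carrier (env_alg S) \<Longrightarrow> b \<in> carrier (env_alg S) \<Longrightarrow> UU_tensor S a b \<in> carrier (UU S)"
  unfolding UU_tensor_def by (rule ring_hom_closed[OF UU_hom]) auto

lemma UU_tensor_add_left:
  assumes "open S" "a \<in> carrier (env_alg S)" "a' \<in> carrier (env_alg S)" "b \<in> carrier (env_alg S)"
  shows "UU_tensor S (a \<oplus>\<^bsub>env_alg S\<^esub> a') b = UU_tensor S a b \<oplus>\<^bsub>UU S\<^esub> UU_tensor S a' b"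
proof -
  let ?M = "monoid_algebra (env_alg S \<times>\<times> env_alg S)"
  let ?I = "tensor_ideal (env_alg S) (env_scalar S) (env_alg S) (env_scalar S)"
  interpret M: ring ?M
    by (rule tensor_square_ring[OF assms(1)])
  interpret E: ring "env_alg S"
    by (rule env_alg_ring[OF assms(1)])
  have "UU_tensor S (a \<oplus>\<^bsub>env_alg S\<^esub> a') b = ?I +>\<^bsub>?M\<^esub> (ma_term 1 (a, b) \<oplus>\<^bsub>?M\<^esub> ma_term 1 (a', b))"
    unfolding UU_tensor_def tensor_ideal_def
    by (rule Idl_coset_eq[OF tensor_square_ring tensor_relations_subset])
      (simp_all add: assms tensor_relations_memI)
  also have "\<dots> = UU_tensor S a b \<oplus>\<^bsub>UU S\<^esub> UU_tensor S a' b"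
    unfolding UU_tensor_def using assms by (intro ring_hom_add[OF UU_hom]) auto
  finally show ?thesis .
qed

lemma UU_tensor_add_right:
  assumes "open S" "a \<in> carrier (env_alg S)" "b \<in> carrier (env_alg S)" "b' \<in> carrier (env_alg S)"
  shows "UU_tensor S a (b \<oplus>\<^bsub>env_alg S\<^esub> b') = UU_tensor S a b \<oplus>\<^bsub>UU S\<^esub> UU_tensor S a b'"
proof -
  let ?M = "monoid_algebra (env_alg S \<times>\<times> env_alg S)"
  let ?I = "tensor_ideal (env_alg S) (env_scalar S) (env_alg S) (env_scalar S)"
  interpret M: ring ?M
    by (rule tensor_square_ring[OF assms(1)])
  interpret E: ring "env_alg S"
    by (rule env_alg_ring[OF assms(1)])
  have "UU_tensor S a (b \<oplus>\<^bsub>env_alg S\<^esub> b') = ?I +>\<^bsub>?M\<^esub> (ma_term 1 (a, b) \<oplus>\<^bsub>?M\<^esub> ma_term 1 (a, b'))"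
    unfolding UU_tensor_def tensor_ideal_def
    by (rule Idl_coset_eq[OF tensor_square_ring tensor_relations_subset])
      (simp_all add: assms tensor_relations_memI)
  also have "\<dots> = UU_tensor S a b \<oplus>\<^bsub>UU S\<^esub> UU_tensor S a b'"
    unfolding UU_tensor_def using assms by (intro ring_hom_add[OF UU_hom]) auto
  finally show ?thesis .
qed

text \<open>Both sides are the class of \<open>ma_term s (a, b)\<close>.\<close>

lemma UU_tensor_scalar_swap:
  assumes "open S" "a \<in> carrier (env_alg S)" "b \<in> carrier (env_alg S)"
  shows "UU_tensor S (env_scalar S s \<otimes>\<^bsub>env_alg S\<^esub> a) b = UU_tensor S a (env_scalar S s \<otimes>\<^bsub>env_alg S\<^esub> b)"
proof -
  let ?M = "monoid_algebra (env_alg S \<times>\<times> env_alg S)"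
  let ?I = "tensor_ideal (env_alg S) (env_scalar S) (env_alg S) (env_scalar S)"
  interpret E: ring "env_alg S"
    by (rule env_alg_ring[OF assms(1)])
  have "UU_tensor S (env_scalar S s \<otimes>\<^bsub>env_alg S\<^esub> a) b = ?I +>\<^bsub>?M\<^esub> ma_term s (a, b)"
    unfolding UU_tensor_def tensor_ideal_def
    by (rule Idl_coset_eq[OF tensor_square_ring tensor_relations_subset])
      (simp_all add: assms tensor_relations_memI env_scalar_closed)
  moreover have "UU_tensor S a (env_scalar S s \<otimes>\<^bsub>env_alg S\<^esub> b) = ?I +>\<^bsub>?M\<^esub> ma_term s (a, b)"
    unfolding UU_tensor_def tensor_ideal_def
    by (rule Idl_coset_eq[OF tensor_square_ring tensor_relations_subset])
      (simp_all add: assms tensor_relations_memI env_scalar_closed)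
  ultimately show ?thesis
    by simp
qed

section \<open>The antisymmetrised tensor and the moves that conserve the twist\<close>

definition field_tensor :: "point set \<Rightarrow> vfield \<Rightarrow> vfield \<Rightarrow> (env_elem \<times> env_elem \<Rightarrow> complex) set" where
  "field_tensor S X Y = UU_tensor S (env_incl S X) (env_incl S Y)"

lemma field_tensor_closed:
  "open S \<Longrightarrow> X \<in> vfields S \<Longrightarrow> Y \<in> vfields S \<Longrightarrow> field_tensor S X Y \<in> carrier (UU S)"
  by (simp add: field_tensor_def UU_tensor_closed env_incl_closed)

lemma field_tensor_add:
  assumes "open S" "X \<in> vfields S" "Y \<in> vfields S" "Z \<in> vfields S"
  shows "field_tensor S (\<lambda>p. X p + Y p) Z = field_tensor S X Z \<oplus>\<^bsub>UU S\<^esub> field_tensor S Y Z"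
    and "field_tensor S Z (\<lambda>p. X p + Y p) = field_tensor S Z X \<oplus>\<^bsub>UU S\<^esub> field_tensor S Z Y"
  using assms by (simp_all add: field_tensor_def env_incl_add env_incl_closed
      UU_tensor_add_left UU_tensor_add_right)

lemma field_tensor_scaleR_swap:
  assumes "open S" "X \<in> vfields S" "Y \<in> vfields S"
  shows "field_tensor S (\<lambda>p. a *\<^sub>R X p) Y = field_tensor S X (\<lambda>p. a *\<^sub>R Y p)"
  using assms by (simp add: field_tensor_def env_incl_scaleR env_incl_closed UU_tensor_scalar_swap)

text \<open>Additivity at \<open>0 = 0 + 0\<close> gives \<open>T = T + T\<close> for such a tensor
  \<open>T\<close>, which forces \<open>T\<close> to be zero in a ring.\<close>

lemma field_tensor_zero:
  assumes "open S" "X \<in> vfields S"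
  shows "field_tensor S X (\<lambda>_. 0) = \<zero>\<^bsub>UU S\<^esub>" "field_tensor S (\<lambda>_. 0) X = \<zero>\<^bsub>UU S\<^esub>"
proof -
  interpret U: ring "UU S"
    by (rule UU_ring[OF assms(1)])
  have zeroI: "T = \<zero>\<^bsub>UU S\<^esub>" if "T \<in> carrier (UU S)" "T = T \<oplus>\<^bsub>UU S\<^esub> T" for T
    using U.add.l_cancel_one'[OF that(1,1)] that(2) by (rule iffD1)
  have add: "field_tensor S (\<lambda>_. 0) X = field_tensor S (\<lambda>_. 0) X \<oplus>\<^bsub>UU S\<^esub> field_tensor S (\<lambda>_. 0) X"
    "field_tensor S X (\<lambda>_. 0) = field_tensor S X (\<lambda>_. 0) \<oplus>\<^bsub>UU S\<^esub> field_tensor S X (\<lambda>_. 0)"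
    by (rule field_tensor_add[OF assms(1) zero_in_vfields zero_in_vfields assms(2), simplified])+
  show "field_tensor S X (\<lambda>_. 0) = \<zero>\<^bsub>UU S\<^esub>" "field_tensor S (\<lambda>_. 0) X = \<zero>\<^bsub>UU S\<^esub>"
    by (rule zeroI[OF field_tensor_closed[OF assms zero_in_vfields] add(2)])
      (rule zeroI[OF field_tensor_closed[OF assms(1) zero_in_vfields assms(2)] add(1)])
qed

text \<open>Every coefficient of the exponential depends on the two fields only through their
  antisymmetrised tensor.\<close>

lemma twist_eqI:
  assumes "field_tensor S V1 V2 \<ominus>\<^bsub>UU S\<^esub> field_tensor S V2 V1 =
    field_tensor S W1 W2 \<ominus>\<^bsub>UU S\<^esub> field_tensor S W2 W1"
  shows "twist S V1 V2 = twist S W1 W2"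
  using assms by (simp add: fun_eq_iff twist_def field_tensor_def)

lemma (in ring) minus_add_cancel:
  "a \<in> carrier R \<Longrightarrow> b \<in> carrier R \<Longrightarrow> c \<in> carrier R \<Longrightarrow> (a \<oplus> c) \<ominus> (b \<oplus> c) = a \<ominus> b"
  by algebra

text \<open>Abstract form of \<open>X \<otimes> Y - Y \<otimes> X = Y \<otimes> (- X) - (- X)
  \<otimes> Y\<close>. The sign sits inside a tensor factor, so the tensors with \<open>- X\<close>
  are known only as additive inverses.\<close>

lemma (in ring) minus_eq_minus_of_inverses:
  assumes "a \<in> carrier R" "b \<in> carrier R" "a' \<in> carrier R" "b' \<in> carrier R" "a' \<oplus> a = \<zero>" "b' \<oplus> b = \<zero>"
  shows "a \<ominus> b = b' \<ominus> a'"
proof -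
  have "a' = \<ominus> a" "b' = \<ominus> b"
    using assms minus_equality by metis+
  then show ?thesis
    using assms(1,2) by algebra
qed

text \<open>The extra terms \<open>a Y \<otimes> Y\<close> and \<open>Y \<otimes> a Y\<close>
  coincide once the real scalar is moved across, so they cancel in the antisymmetrisation.\<close>

lemma twist_add:
  assumes "open S" "X \<in> vfields S" "Y \<in> vfields S"
  shows "twist S X Y = twist S (\<lambda>p. X p + a *\<^sub>R Y p) Y"
proof (rule twist_eqI)
  interpret U: ring "UU S"
    by (rule UU_ring[OF assms(1)])
  let ?A = "field_tensor S X Y" and ?B = "field_tensor S Y X" and ?C = "field_tensor S Y (\<lambda>p. a *\<^sub>R Y p)"
  have c: "?A \<in> carrier (UU S)" "?B \<in> carrier (UU S)" "?C \<in> carrier (UU S)"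
    using assms by (simp_all add: field_tensor_closed scaleR_in_vfields)
  have "field_tensor S (\<lambda>p. X p + a *\<^sub>R Y p) Y \<ominus>\<^bsub>UU S\<^esub> field_tensor S Y (\<lambda>p. X p + a *\<^sub>R Y p)
      = (?A \<oplus>\<^bsub>UU S\<^esub> ?C) \<ominus>\<^bsub>UU S\<^esub> (?B \<oplus>\<^bsub>UU S\<^esub> ?C)"
    using assms by (simp add: field_tensor_add scaleR_in_vfields field_tensor_scaleR_swap)
  also have "\<dots> = ?A \<ominus>\<^bsub>UU S\<^esub> ?B"
    using c by (rule U.minus_add_cancel)
  finally show "?A \<ominus>\<^bsub>UU S\<^esub> ?B =
      field_tensor S (\<lambda>p. X p + a *\<^sub>R Y p) Y \<ominus>\<^bsub>UU S\<^esub> field_tensor S Y (\<lambda>p. X p + a *\<^sub>R Y p)"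
    by simp
qed

lemma twist_swap:
  assumes "open S" "X \<in> vfields S" "Y \<in> vfields S"
  shows "twist S X Y = twist S Y (\<lambda>p. - X p)"
proof (rule twist_eqI)
  interpret U: ring "UU S"
    by (rule UU_ring[OF assms(1)])
  let ?X' = "\<lambda>p. - X p"
  have X': "?X' \<in> vfields S"
    using scaleR_in_vfields[OF assms(1,2), of "-1"] by simp
  have c: "field_tensor S X Y \<in> carrier (UU S)" "field_tensor S Y X \<in> carrier (UU S)"
    "field_tensor S ?X' Y \<in> carrier (UU S)" "field_tensor S Y ?X' \<in> carrier (UU S)"
    using assms X' by (simp_all add: field_tensor_closed)
  have "field_tensor S ?X' Y \<oplus>\<^bsub>UU S\<^esub> field_tensor S X Y = \<zero>\<^bsub>UU S\<^esub>"
    "field_tensor S Y ?X' \<oplus>\<^bsub>UU S\<^esub> field_tensor S Y X = \<zero>\<^bsub>UU S\<^esub>"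
    using field_tensor_add[OF assms(1) X' assms(2,3)] field_tensor_zero[OF assms(1,3)] by simp_all
  then show "field_tensor S X Y \<ominus>\<^bsub>UU S\<^esub> field_tensor S Y X =
      field_tensor S Y ?X' \<ominus>\<^bsub>UU S\<^esub> field_tensor S ?X' Y"
    by (rule U.minus_eq_minus_of_inverses[OF c])
qed

lemma twist_zero:
  assumes "open S" "X \<in> vfields S" "Y \<in> vfields S"
  shows "twist S X (\<lambda>_. 0) = twist S Y (\<lambda>_. 0)"
  by (rule twist_eqI) (simp add: assms field_tensor_zero)

lemma twist_conserving_refl: "commuting_fields S V1 V2 \<Longrightarrow> twist_conserving S V1 V2 V1 V2"
  by (simp add: twist_conserving_def)

lemma twist_conserving_trans:
  "twist_conserving S U1 U2 V1 V2 \<Longrightarrow> twist_conserving S V1 V2 W1 W2 \<Longrightarrow> twist_conserving S U1 U2 W1 W2"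
  by (simp add: twist_conserving_def)

lemma twist_conserving_add:
  assumes "open S" "commuting_fields S V1 V2"
  shows "twist_conserving S V1 V2 (\<lambda>p. V1 p + a *\<^sub>R V2 p) V2"
  unfolding twist_conserving_def
  using assms(2) commuting_fields_add[OF assms] twist_add[OF assms(1), of V1 V2 a]
  by (simp add: commuting_fields_def)

lemma twist_conserving_swap:
  assumes "open S" "commuting_fields S V1 V2"
  shows "twist_conserving S V1 V2 V2 (\<lambda>p. - V1 p)"
  unfolding twist_conserving_def
  using assms(2) commuting_fields_swap[OF assms] twist_swap[OF assms(1), of V1 V2]
  by (simp add: commuting_fields_def)

text \<open>With one field zero the exponent is zero whatever the other field is. This replacement
  is not a linear move; it handles pairs that degenerate to a single field.\<close>

lemma twist_conserving_zero:
  assumes "open S" "V \<in> vfields S" "W \<in> vfields S"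
  shows "twist_conserving S V (\<lambda>_. 0) W (\<lambda>_. 0)"
  unfolding twist_conserving_def using assms by (blast intro: commuting_fields_zero twist_zero)

subsection \<open>Spherically symmetric fields\<close>

text \<open>Contracting the Levi-Civita symbol turns the rotational part into the linear field
  \<open>cross3 d x\<close>, so that brackets of rotations become cross product identities.\<close>

lemma bh_field_eq:
  "bh_field J c N d f p = (if norm (snd p) \<in> J then
     (c (norm (snd p)) + N * fst p, cross3 d (snd p) + f (norm (snd p)) *\<^sub>R snd p) else 0)"
proof -
  have "(\<Sum>i\<in>UNIV. (d $ i) *\<^sub>R rotation i p) = (0, cross3 d (snd p))"
    by (simp add: prod_eq_iff fst_sum snd_sum rotation_def partial_x_def levi_civita_def sum_3
        vec_eq_iff forall_3 cross_components axis_def)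
  moreover have "(\<Sum>i\<in>UNIV. (f (norm (snd p)) * snd p $ i) *\<^sub>R partial_x i p) =
      (0, f (norm (snd p)) *\<^sub>R snd p)"
    by (simp add: prod_eq_iff fst_sum snd_sum partial_x_def sum_3 vec_eq_iff forall_3 axis_def)
  ultimately show ?thesis
    by (simp add: bh_field_def shell_def partial_t_def zero_prod_def)
qed

lemma open_shell: "open J \<Longrightarrow> open (shell J)"
  unfolding shell_def using open_vimage[of J "\<lambda>p::point. norm (snd p)"]
  by (simp add: vimage_def continuous_on_norm continuous_on_snd)

lemma bh_field_restrict:
  "J \<subseteq> I \<Longrightarrow> bh_field J c N d f = (\<lambda>p. if p \<in> shell J then bh_field I c N d f p else 0)"
  by (intro ext) (auto simp: bh_field_eq shell_def)

lemma bh_field_cong: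
  "(\<And>r. r \<in> J \<Longrightarrow> c r = c' r) \<Longrightarrow> (\<And>r. r \<in> J \<Longrightarrow> f r = f' r) \<Longrightarrow>
    bh_field J c N d f = bh_field J c' N d f'"
  by (intro ext) (auto simp: bh_field_eq)

lemma bh_field_add:
  "(\<lambda>p. bh_field J c1 N1 d1 f1 p + a *\<^sub>R bh_field J c2 N2 d2 f2 p) =
    bh_field J (\<lambda>r. c1 r + a * c2 r) (N1 + a * N2) (d1 + a *\<^sub>R d2) (\<lambda>r. f1 r + a * f2 r)"
  by (auto simp: bh_field_eq cross_add_left cross_mult_left algebra_simps)

lemma bh_field_uminus:
  "(\<lambda>p. - bh_field J c N d f p) = bh_field J (\<lambda>r. - c r) (- N) (- d) (\<lambda>r. - f r)"
  by (auto simp: bh_field_eq zero_prod_def)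

text \<open>The coefficients are recovered on the ray \<open>t = 0\<close>, \<open>x = s e\<close>
  with \<open>e\<close> the first axis vector: the time component is \<open>c s\<close>, and the
  component along \<open>e\<close> is \<open>s * f s\<close>, because \<open>cross3 d x\<close> is
  orthogonal to \<open>x\<close>. Positive radii make the norm equal to \<open>s\<close> and allow
  the division by \<open>s\<close>.\<close>

lemma bh_field_differentiable_coeffs:
  assumes "bh_field J c N d f \<in> vfields (shell J)" "J \<subseteq> {0<..}" "open J" "r \<in> J"
  shows "c differentiable at r" "f differentiable at r"
proof -
  let ?X = "bh_field J c N d f" and ?e = "axis 1 1 :: real^3"
  define l where "l = (\<lambda>s::real. (0::real, s *\<^sub>R ?e))"
  have norm: "norm (snd (l s)) = s" if "s \<in> J" for s
    using that assms by (auto simp: l_def)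
  have "?X differentiable at (l r)"
    using assms norm by (intro smooth_on_imp_differentiable[of "shell J"]) (auto simp: vfields_def shell_def)
  moreover have "l differentiable at r"
    unfolding l_def by (intro bounded_linear_imp_differentiable bounded_linear_intros)
  ultimately have *: "(\<lambda>s. ?X (l s)) differentiable at r"
    using differentiable_chain_at[of l r ?X] by (simp add: o_def)
  have trans: "g differentiable at r" if "h differentiable at r" "\<And>s. s \<in> J \<Longrightarrow> h s = g s" for g h :: "real \<Rightarrow> real"
    using that has_derivative_transform_within_open[of h _ r UNIV J g] \<open>open J\<close> \<open>r \<in> J\<close>
    unfolding differentiable_def by blast
  from * obtain D where D: "((\<lambda>s. ?X (l s)) has_derivative D) (at r)"
    by (auto simp: differentiable_def)
  have "(\<lambda>s. fst (?X (l s))) differentiable at r"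
    using has_derivative_fst[OF D] by (auto simp: differentiable_def)
  then show "c differentiable at r"
    by (rule trans) (simp add: bh_field_eq norm, simp add: l_def)
  have "(\<lambda>s. snd (?X (l s)) \<bullet> ?e) differentiable at r"
    using has_derivative_inner_left[OF has_derivative_snd[OF D]] by (auto simp: differentiable_def)
  then have "(\<lambda>s. (snd (?X (l s)) \<bullet> ?e) / s) differentiable at r"
    using assms by (intro differentiable_divide) auto
  then show "f differentiable at r"
  proof (rule trans)
    fix s assume "s \<in> J"
    then have "s > 0"
      using assms by auto
    have "cross3 d (s *\<^sub>R ?e) \<bullet> ?e = 0"
      by (simp add: cross_mult_right dot_cross_self)
    then show "snd (?X (l s)) \<bullet> ?e / s = f s"
      using \<open>s \<in> J\<close> \<open>s > 0\<close> by (simp add: bh_field_eq norm) (simp add: l_def inner_add_left inner_axis_axis)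
  qed
qed

text \<open>Away from the origin the norm has derivative \<open>x \<bullet> y / r\<close> in
  direction \<open>y\<close>; the chain rule then asks for the coefficients only at the single
  radius \<open>r\<close>.\<close>

lemma bh_field_has_derivative:
  assumes "open J" "J \<subseteq> {0<..}" "c differentiable at r" "f differentiable at r" "r \<in> J" "norm x = r"
  shows "(bh_field J c N d f has_derivative (\<lambda>(s, y). (deriv c r * (x \<bullet> y / r) + N * s,
     cross3 d y + (deriv f r * (x \<bullet> y / r)) *\<^sub>R x + f r *\<^sub>R y))) (at (t, x))"
proof -
  have "x \<noteq> 0" "r > 0"
    using assms by auto
  have n: "((\<lambda>p::point. norm (snd p)) has_derivative (\<lambda>p. x \<bullet> snd p / r)) (at (t, x))"
    using has_derivative_compose[OF bounded_linear_imp_has_derivative[OF bounded_linear_snd], of norm "\<lambda>h. h \<bullet> sgn x" "(t, x)"]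
      has_derivative_norm[OF \<open>x \<noteq> 0\<close>] assms by (simp add: sgn_div_norm inner_commute divide_inverse mult.commute)
  have "((\<lambda>p::point. c (norm (snd p))) has_derivative (\<lambda>p. deriv c r * (x \<bullet> snd p / r))) (at (t, x))"
    using has_derivative_compose[OF n, of c "(*) (deriv c r)"] assms
    by (simp add: has_field_derivative_def[symmetric] DERIV_deriv_iff_real_differentiable)
  moreover have "((\<lambda>p::point. f (norm (snd p))) has_derivative (\<lambda>p. deriv f r * (x \<bullet> snd p / r))) (at (t, x))"
    using has_derivative_compose[OF n, of f "(*) (deriv f r)"] assms
    by (simp add: has_field_derivative_def[symmetric] DERIV_deriv_iff_real_differentiable)
  moreover have "((\<lambda>p::point. cross3 d (snd p)) has_derivative (\<lambda>p. cross3 d (snd p))) (at (t, x))"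
    by (intro bounded_linear_imp_has_derivative)
      (auto simp: linear_conv_bounded_linear[symmetric] linear_iff cross_add_right cross_mult_right)
  ultimately have "((\<lambda>p::point. (c (norm (snd p)) + N * fst p, cross3 d (snd p) + f (norm (snd p)) *\<^sub>R snd p))
      has_derivative (\<lambda>p. (deriv c r * (x \<bullet> snd p / r) + N * fst p,
        cross3 d (snd p) + (f r *\<^sub>R snd p + (deriv f r * (x \<bullet> snd p / r)) *\<^sub>R x)))) (at (t, x))"
    using assms by (auto intro!: derivative_eq_intros)
  then have "(bh_field J c N d f has_derivative (\<lambda>p. (deriv c r * (x \<bullet> snd p / r) + N * fst p,
        cross3 d (snd p) + (f r *\<^sub>R snd p + (deriv f r * (x \<bullet> snd p / r)) *\<^sub>R x)))) (at (t, x))"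
    by (rule has_derivative_transform_within_open[OF _ open_shell[OF assms(1)]])
      (use assms in \<open>auto simp: shell_def bh_field_eq\<close>)
  then show ?thesis
    by (simp add: case_prod_beta' algebra_simps)
qed

lemma lie_bracket_bh_field:
  assumes J: "open J" "J \<subseteq> {0<..}"
    and V: "bh_field J c1 N1 d1 f1 \<in> vfields (shell J)" "bh_field J c2 N2 d2 f2 \<in> vfields (shell J)"
    and r: "r \<in> J" "norm x = r"
  shows "lie_bracket (shell J) (bh_field J c1 N1 d1 f1) (bh_field J c2 N2 d2 f2) (t, x) =
    (N2 * c1 r - N1 * c2 r + r * (f1 r * deriv c2 r - f2 r * deriv c1 r),
     (r * (f1 r * deriv f2 r - f2 r * deriv f1 r)) *\<^sub>R x - cross3 (cross3 d1 d2) x)"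
proof -
  have "r > 0"
    using J r by auto
  have D: "frechet_derivative (bh_field J c N d f) (at (t, x)) = (\<lambda>(s, y). (deriv c r * (x \<bullet> y / r) + N * s,
     cross3 d y + (deriv f r * (x \<bullet> y / r)) *\<^sub>R x + f r *\<^sub>R y))"
    if "bh_field J c N d f \<in> vfields (shell J)" for c N d f
    using that J r
    by (intro frechet_derivative_at[symmetric] bh_field_has_derivative bh_field_differentiable_coeffs)
  \<comment> \<open>The Jacobi identity turns the commutator of two rotations into one rotation
    about \<open>cross3 d1 d2\<close>.\<close>
  have jacobi: "cross3 d2 (cross3 d1 x) = cross3 d1 (cross3 d2 x) - cross3 (cross3 d1 d2) x"
    by (simp add: vec_eq_iff forall_3 cross_components algebra_simps)
  \<comment> \<open>Rotations move points along spheres, so the derivative of the norm sees only the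
    radial coefficient.\<close>
  have radial: "x \<bullet> (cross3 d x + a *\<^sub>R x) = a * r * r" for d a
    using r by (simp add: inner_add_right dot_cross_self dot_square_norm power2_eq_square)
  have "lie_bracket (shell J) (bh_field J c1 N1 d1 f1) (bh_field J c2 N2 d2 f2) (t, x) =
    (deriv c2 r * (f1 r * r) + N2 * (c1 r + N1 * t),
      cross3 d2 (cross3 d1 x + f1 r *\<^sub>R x) + (deriv f2 r * (f1 r * r)) *\<^sub>R x + f2 r *\<^sub>R (cross3 d1 x + f1 r *\<^sub>R x))
    - (deriv c1 r * (f2 r * r) + N1 * (c2 r + N2 * t),
      cross3 d1 (cross3 d2 x + f2 r *\<^sub>R x) + (deriv f1 r * (f2 r * r)) *\<^sub>R x + f1 r *\<^sub>R (cross3 d2 x + f2 r *\<^sub>R x))"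
    using r by (simp add: lie_bracket_def D[OF V(1)] D[OF V(2)] shell_def bh_field_eq radial \<open>r > 0\<close>)
  then show ?thesis
    by (simp add: cross_add_right cross_mult_right jacobi algebra_simps)
qed

lemma commuting_bh_fields_iff:
  assumes J: "open J" "J \<noteq> {}" "J \<subseteq> {0<..}"
    and V: "bh_field J c1 N1 d1 f1 \<in> vfields (shell J)" "bh_field J c2 N2 d2 f2 \<in> vfields (shell J)"
  shows "commuting_fields (shell J) (bh_field J c1 N1 d1 f1) (bh_field J c2 N2 d2 f2) \<longleftrightarrow>
    cross3 d1 d2 = 0 \<and>
    (\<forall>r\<in>J. f1 r * deriv f2 r = f2 r * deriv f1 r \<and>
           N2 * c1 r - N1 * c2 r + r * (f1 r * deriv c2 r - f2 r * deriv c1 r) = 0)"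
    (is "?L \<longleftrightarrow> ?D \<and> (\<forall>r\<in>J. ?F r \<and> ?C r)")
proof
  assume ?L
  then have L: "lie_bracket (shell J) (bh_field J c1 N1 d1 f1) (bh_field J c2 N2 d2 f2) (0, x) = 0" for x
    by (simp add: commuting_fields_def)
  have C: "?C r" and E: "(r * (f1 r * deriv f2 r - f2 r * deriv f1 r)) *\<^sub>R x = cross3 (cross3 d1 d2) x"
    if "r \<in> J" "norm x = r" for r x
    using L[of x] lie_bracket_bh_field[OF J(1,3) V that, of 0] by (simp_all add: zero_prod_def)
  have F: "?F r" if "r \<in> J" for r
  proof -
    define x where "x = r *\<^sub>R (axis 1 1 :: real^3)"
    have "r > 0"
      using that J by auto
    then have x: "norm x = r" "x \<noteq> 0"
      by (auto simp: x_def)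
    \<comment> \<open>Pairing with \<open>x\<close> removes the tangential rotation and leaves the
      Wronskian.\<close>
    have "(r * (f1 r * deriv f2 r - f2 r * deriv f1 r)) * (x \<bullet> x) = 0"
      using arg_cong[OF E[OF that x(1)], of "\<lambda>y. y \<bullet> x"] by (simp add: dot_cross_self)
    then show ?thesis
      using \<open>r > 0\<close> x by simp
  qed
  obtain r where "r \<in> J"
    using J by auto
  then have "r > 0"
    using J by auto
  have "cross3 (cross3 d1 d2) (axis i 1) = 0" for i :: 3
  proof -
    have "r *\<^sub>R cross3 (cross3 d1 d2) (axis i 1) = 0"
      using E[of r "r *\<^sub>R axis i 1"] F[OF \<open>r \<in> J\<close>] \<open>r \<in> J\<close> \<open>r > 0\<close> by (simp add: cross_mult_right)
    then show ?thesis
      using \<open>r > 0\<close> by simp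
  qed
  \<comment> \<open>A vector parallel to two different axes is zero.\<close>
  from this[of 1] this[of 2] have ?D
    by (simp add: vec_eq_iff forall_3 cross_components axis_def)
  moreover have "?C r" if "r \<in> J" for r
    using C[OF that, of "r *\<^sub>R axis 1 1"] that J by auto
  ultimately show "?D \<and> (\<forall>r\<in>J. ?F r \<and> ?C r)"
    using F by blast
next
  assume R: "?D \<and> (\<forall>r\<in>J. ?F r \<and> ?C r)"
  have "lie_bracket (shell J) (bh_field J c1 N1 d1 f1) (bh_field J c2 N2 d2 f2) p = 0" for p
  proof (cases "p \<in> shell J")
    case True
    then show ?thesis
      using R lie_bracket_bh_field[OF J(1,3) V, of "norm (snd p)" "snd p" "fst p"]
      by (simp add: shell_def zero_prod_def)
  qed (simp add: lie_bracket_def)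
  then show ?L
    using V by (auto simp: commuting_fields_def)
qed

subsection \<open>Vanishing Wronskians and analytic functions\<close>

text \<open>Up to sign the Wronskian is the numerator in the quotient rule for \<open>f / g\<close>,
  so this quotient is constant on an interval.\<close>

lemma parallel_of_wronskian_zero:
  fixes f g :: "real \<Rightarrow> real"
  assumes "connected J" "\<And>r. r \<in> J \<Longrightarrow> f differentiable at r" "\<And>r. r \<in> J \<Longrightarrow> g differentiable at r"
    and "\<And>r. r \<in> J \<Longrightarrow> f r * deriv g r = g r * deriv f r" "\<And>r. r \<in> J \<Longrightarrow> g r \<noteq> 0"
  shows "\<exists>k. \<forall>r\<in>J. f r = k * g r"
proof -
  have "((\<lambda>r. f r / g r) has_field_derivative 0) (at r within J)" if "r \<in> J" for r
  proof -
    have "(f has_field_derivative deriv f r) (at r)" "(g has_field_derivative deriv g r) (at r)"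
      using assms that by (simp_all add: DERIV_deriv_iff_real_differentiable)
    then have "((\<lambda>r. f r / g r) has_field_derivative
        (deriv f r * g r - f r * deriv g r) / (g r * g r)) (at r)"
      using assms(5)[OF that] by (rule DERIV_divide)
    then show ?thesis
      using assms(4)[OF that] by (simp add: mult.commute has_field_derivative_at_within)
  qed
  then obtain k where "\<And>r. r \<in> J \<Longrightarrow> f r / g r = k"
    using has_field_derivative_zero_constant[of J "\<lambda>r. f r / g r"] assms(1)
    by (auto simp: connected_convex_1)
  then show ?thesis
    using assms(5) by (metis nonzero_eq_divide_eq)
qed

text \<open>The direction of the nowhere vanishing vector \<open>(f, g)\<close> is locally constant, because
  \<open>f\<^sup>2\<close> and \<open>f g\<close> both have vanishing Wronskian with \<open>f\<^sup>2 + g\<^sup>2\<close>.\<close>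
lemma linearly_dependent_of_wronskian_zero:
  fixes f g :: "real \<Rightarrow> real"
  assumes "connected J" "J \<noteq> {}" "\<And>r. r \<in> J \<Longrightarrow> f differentiable at r" "\<And>r. r \<in> J \<Longrightarrow> g differentiable at r"
    and W: "\<And>r. r \<in> J \<Longrightarrow> f r * deriv g r = g r * deriv f r" and nz: "\<And>r. r \<in> J \<Longrightarrow> f r \<noteq> 0 \<or> g r \<noteq> 0"
  shows "\<exists>a b. (a \<noteq> 0 \<or> b \<noteq> 0) \<and> (\<forall>r\<in>J. a * f r + b * g r = 0)"
proof -
  let ?q = "\<lambda>r. f r * f r + g r * g r"
  have D: "(f has_field_derivative deriv f r) (at r)" "(g has_field_derivative deriv g r) (at r)"
    if "r \<in> J" for r
    using assms that by (simp_all add: DERIV_deriv_iff_real_differentiable)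
  have q: "(?q has_field_derivative 2 * (f r * deriv f r + g r * deriv g r)) (at r)"
    and ff: "((\<lambda>r. f r * f r) has_field_derivative 2 * f r * deriv f r) (at r)"
    and fg: "((\<lambda>r. f r * g r) has_field_derivative deriv f r * g r + deriv g r * f r) (at r)"
    if "r \<in> J" for r
    by (auto intro!: derivative_eq_intros D[OF that])
  have q0: "?q r \<noteq> 0" if "r \<in> J" for r
    using nz[OF that] by (simp add: sum_squares_eq_zero_iff)
  have diff: "h differentiable at r" "deriv h r = h'" if "(h has_field_derivative h') (at r)" for h h' and r :: real
    using that real_differentiable_def DERIV_imp_deriv by blast+
  have "\<exists>A. \<forall>r\<in>J. f r * f r = A * ?q r"
  proof (rule parallel_of_wronskian_zero[OF assms(1)])
    fix r assume r: "r \<in> J"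
    have "f r * f r * (2 * (f r * deriv f r + g r * deriv g r)) =
        2 * f r * f r * f r * deriv f r + 2 * f r * g r * (f r * deriv g r)"
      by (simp add: algebra_simps)
    also have "\<dots> = ?q r * (2 * f r * deriv f r)"
      unfolding W[OF r] by (simp add: algebra_simps)
    finally show "f r * f r * deriv ?q r = ?q r * deriv (\<lambda>r. f r * f r) r"
      by (simp add: diff(2)[OF q[OF r]] diff(2)[OF ff[OF r]])
  qed (use q q0 ff diff in blast)+
  then obtain A where A: "\<And>r. r \<in> J \<Longrightarrow> f r * f r = A * ?q r"
    by blast
  have "\<exists>B. \<forall>r\<in>J. f r * g r = B * ?q r"
  proof (rule parallel_of_wronskian_zero[OF assms(1)])
    fix r assume r: "r \<in> J"
    have "f r * g r * (2 * (f r * deriv f r + g r * deriv g r)) =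
        2 * f r * f r * (g r * deriv f r) + 2 * g r * g r * (f r * deriv g r)"
      by (simp add: algebra_simps)
    also have "\<dots> = f r * f r * (g r * deriv f r) + f r * f r * (f r * deriv g r) +
        g r * g r * (g r * deriv f r) + g r * g r * (f r * deriv g r)"
      unfolding W[OF r] by (simp add: algebra_simps)
    also have "\<dots> = ?q r * (deriv f r * g r + deriv g r * f r)"
      by (simp add: algebra_simps)
    finally show "f r * g r * deriv ?q r = ?q r * deriv (\<lambda>r. f r * g r) r"
      by (simp add: diff(2)[OF q[OF r]] diff(2)[OF fg[OF r]])
  qed (use q q0 fg diff in blast)+
  then obtain B where B: "\<And>r. r \<in> J \<Longrightarrow> f r * g r = B * ?q r"
    by blast
  \<comment> \<open>If the constant direction of \<open>(f, g)\<close> has angle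
    \<open>\<theta>\<close>, then \<open>A\<close> is the squared cosine and \<open>B\<close> the
    product of cosine and sine. For \<open>A \<noteq> 0\<close> the vector \<open>(- B, A)\<close>
    is orthogonal to \<open>(f, g)\<close>; for \<open>A = 0\<close> the function \<open>f\<close>
    itself vanishes.\<close>
  show ?thesis
  proof (cases "A = 0")
    case True
    then have "f r = 0" if "r \<in> J" for r
      using A[OF that] by simp
    then show ?thesis
      by (intro exI[of _ 1] exI[of _ 0]) simp
  next
    case False
    have "A * g r = B * f r" if "r \<in> J" for r
    proof -
      have "?q r * (A * g r) = f r * (f r * g r)"
        using arg_cong[OF A[OF that], of "\<lambda>y. y * g r"] by (simp only: mult_ac)
      also have "\<dots> = ?q r * (B * f r)"
        unfolding B[OF that] by (simp only: mult_ac)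
      finally show ?thesis
        using nz[OF that] by auto
    qed
    then show ?thesis
      using False by (intro exI[of _ "- B"] exI[of _ A]) simp
  qed
qed

section \<open>Zeros of analytic functions, and constancy across isolated points\<close>

lemma real_analytic_on_linear_combination:
  assumes "real_analytic_on f I" "real_analytic_on g I"
  shows "real_analytic_on (\<lambda>r. f r + k * g r) I"
  unfolding real_analytic_on_def
proof
  fix x assume x: "x \<in> I"
  obtain a e where a: "e > 0" "\<And>y. \<bar>y - x\<bar> < e \<Longrightarrow> (\<lambda>n. a n * (y - x) ^ n) sums f y"
    using assms(1) x unfolding real_analytic_on_def by blast
  obtain b e' where b: "e' > 0" "\<And>y. \<bar>y - x\<bar> < e' \<Longrightarrow> (\<lambda>n. b n * (y - x) ^ n) sums g y"
    using assms(2) x unfolding real_analytic_on_def by blast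
  have "(\<lambda>n. (a n + k * b n) * (y - x) ^ n) sums (f y + k * g y)" if "\<bar>y - x\<bar> < min e e'" for y
    using sums_add[OF a(2) sums_mult[OF b(2)], of y y k] that by (simp add: algebra_simps)
  then show "\<exists>a e. e > 0 \<and> (\<forall>y. \<bar>y - x\<bar> < e \<longrightarrow> (\<lambda>n. a n * (y - x) ^ n) sums (f y + k * g y))"
    using a(1) b(1) by (intro exI[of _ "\<lambda>n. a n + k * b n"] exI[of _ "min e e'"]) simp
qed

text \<open>The Taylor coefficients at \<open>x\<close> decide. If all vanish, \<open>f\<close> is
  zero near \<open>x\<close>; if only the constant one is known to vanish, a later nonzero
  coefficient isolates the zero; if \<open>f x \<noteq> 0\<close>, continuity suffices.\<close>

lemma real_analytic_isolated_zero:
  assumes "real_analytic_on f I" "x \<in> I"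
  shows "(\<forall>\<^sub>F y in nhds x. f y = 0) \<or> (\<forall>\<^sub>F y in at x. f y \<noteq> 0)"
proof -
  obtain a e where e: "e > 0" and a: "\<And>y. \<bar>y - x\<bar> < e \<Longrightarrow> (\<lambda>n. a n * (y - x) ^ n) sums f y"
    using assms unfolding real_analytic_on_def by blast
  have "(\<lambda>n. a n * 0 ^ n) sums f x"
    using a[of x] e by simp
  then have fx: "f x = a 0"
    using sums_unique2 powser_sums_zero by blast
  show ?thesis
  proof (cases "\<exists>m. a m \<noteq> 0")
    case False
    then have "f y = 0" if "\<bar>y - x\<bar> < e" for y
      using a[OF that] sums_unique2[OF sums_zero] by auto
    then show ?thesis
      using e unfolding eventually_nhds_metric dist_real_def by blast
  next
    case True
    show ?thesis
    proof (cases "f x = 0")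
      case True
      with fx \<open>\<exists>m. a m \<noteq> 0\<close> obtain m where "a m \<noteq> 0" "m > 0"
        by (metis gr0I)
      with e a True obtain s where "s > 0" "\<And>z. z \<in> cball x s - {x} \<Longrightarrow> f z \<noteq> 0"
        using powser_0_nonzero[of e x a f m] by (auto simp: real_norm_def)
      then have "\<forall>\<^sub>F y in at x. f y \<noteq> 0"
        unfolding eventually_at by (intro exI[of _ s]) (auto simp: dist_commute)
      then show ?thesis ..
    next
      case False
      have "isCont f x"
      proof -
        have "(\<lambda>n. a n * h ^ n) sums f (x + h)" if "\<bar>h\<bar> < e" for h
          using a[of "x + h"] that by simp
        then have "((\<lambda>h. f (x + h)) \<longlongrightarrow> a 0) (at 0)"
          using powser_limit_0[of e a "\<lambda>h. f (x + h)"] e by (simp add: real_norm_def)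
        then show ?thesis
          unfolding isCont_def using fx LIM_offset_zero_iff[of x f "a 0"] by simp
      qed
      then have "\<forall>\<^sub>F y in at x. f y \<noteq> 0"
        using False isCont_def tendsto_imp_eventually_ne by blast
      then show ?thesis ..
    qed
  qed
qed

text \<open>The two local alternatives define disjoint open sets \<open>P\<close> and
  \<open>Q\<close> that cover \<open>I\<close>, and \<open>I\<close> is connected.\<close>

lemma real_analytic_identity:
  assumes "open I" "connected I" "real_analytic_on f I"
  shows "(\<forall>r\<in>I. f r = 0) \<or> (\<forall>r\<in>I. \<forall>\<^sub>F s in at r. f s \<noteq> 0)"
proof -
  define P where "P = {x \<in> I. \<forall>\<^sub>F y in nhds x. f y = 0}"
  define Q where "Q = {x \<in> I. \<forall>\<^sub>F y in at x. f y \<noteq> 0}"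
  have "open P"
    unfolding open_subopen[of P]
  proof
    fix x assume "x \<in> P"
    then obtain T where "open T" "x \<in> T" "\<And>y. y \<in> T \<Longrightarrow> f y = 0"
      by (auto simp: P_def eventually_nhds)
    then show "\<exists>T. open T \<and> x \<in> T \<and> T \<subseteq> P"
      using \<open>x \<in> P\<close> assms(1) by (intro exI[of _ "T \<inter> I"]) (auto simp: P_def eventually_nhds)
  qed
  moreover have "open Q"
    unfolding open_subopen[of Q]
  proof
    fix x assume "x \<in> Q"
    then obtain T where T: "open T" "x \<in> T" "\<And>y. y \<in> T \<Longrightarrow> y \<noteq> x \<Longrightarrow> f y \<noteq> 0"
      by (auto simp: Q_def eventually_at_topological)
    \<comment> \<open>Removing the centre \<open>x\<close>, where \<open>f\<close> may vanish,
      leaves an open neighbourhood of every other \<open>y\<close> in \<open>T\<close> without zeros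
      of \<open>f\<close>.\<close>
    have "\<forall>\<^sub>F z in at y. f z \<noteq> 0" if "y \<in> T" for y
    proof (cases "y = x")
      case True
      then show ?thesis
        using \<open>x \<in> Q\<close> by (simp add: Q_def)
    next
      case False
      then show ?thesis
        using T that unfolding eventually_at_topological
        by (intro exI[of _ "T - {x}"]) (auto intro: open_delete)
    qed
    then show "\<exists>T. open T \<and> x \<in> T \<and> T \<subseteq> Q"
      using T assms(1) \<open>x \<in> Q\<close> by (intro exI[of _ "T \<inter> I"]) (auto simp: Q_def)
  qed
  moreover have "P \<inter> Q = {}"
  proof -
    have False if "\<forall>\<^sub>F y in nhds x. f y = 0" "\<forall>\<^sub>F y in at x. f y \<noteq> 0" for x
    proof -
      have "\<forall>\<^sub>F y in at x. f y = 0"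
        using that(1) by (simp add: eventually_nhds_conv_at)
      with that(2) have "\<forall>\<^sub>F y in at x. False"
        by eventually_elim simp
      then show False
        by simp
    qed
    then show ?thesis
      by (auto simp: P_def Q_def)
  qed
  moreover have "I \<subseteq> P \<union> Q" "P \<subseteq> I" "Q \<subseteq> I"
    using real_analytic_isolated_zero[OF assms(3)] by (auto simp: P_def Q_def)
  ultimately have "P \<inter> I = {} \<or> Q \<inter> I = {}"
    using assms(2) connectedD[of I P Q] by blast
  then have "I \<subseteq> Q \<or> I \<subseteq> P"
    using \<open>I \<subseteq> P \<union> Q\<close> by blast
  then show ?thesis
    unfolding P_def Q_def using eventually_nhds_x_imp_x by blast
qed

text \<open>Meant for \<open>c1\<close>, whose derivative is controlled only where the radial
  coefficient is nonzero. On either side of an exceptional point the mean value theorem needs just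
  continuity at the endpoint, so \<open>f\<close> is constant across it.\<close>

lemma deriv_zero_off_isolated_points_imp_constant:
  fixes f :: "real \<Rightarrow> real"
  assumes "open J" "connected J" "\<And>r. r \<in> J \<Longrightarrow> f differentiable at r"
    and "\<And>r. r \<in> J \<Longrightarrow> \<forall>\<^sub>F s in at r. s \<in> J \<longrightarrow> deriv f s = 0"
  shows "\<exists>k. \<forall>r\<in>J. f r = k"
proof -
  have "(f has_field_derivative 0) (at r)" if r: "r \<in> J" for r
  proof -
    have "\<forall>\<^sub>F s in at r. s \<in> J"
      using assms(1) r by (simp add: eventually_at_in_open')
    with assms(4)[OF r] have "\<forall>\<^sub>F s in at r. s \<in> J \<and> deriv f s = 0"
      by eventually_elim simp
    then obtain e where e: "e > 0" "\<And>s. s \<noteq> r \<Longrightarrow> dist s r < e \<Longrightarrow> s \<in> J \<and> deriv f s = 0"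
      unfolding eventually_at by auto
    have D: "(f has_field_derivative 0) (at s)" if "s \<noteq> r" "dist s r < e" for s
      using e(2)[OF that] assms(3)[of s] DERIV_deriv_iff_real_differentiable by metis
    have C: "continuous_on X f" if "X \<subseteq> ball r e" for X
      using e that assms(3) r
      by (intro continuous_at_imp_continuous_on ballI differentiable_imp_continuous_within)
        (metis dist_commute mem_ball subset_iff)
    have "f s = f r" if "dist s r < e" for s
    proof (cases s r rule: linorder_cases)
      case less
      then show ?thesis
        using that DERIV_isconst_end[OF less C] D by (force simp: dist_real_def)
    next
      case greater
      then show ?thesis
        using that DERIV_isconst_end[OF greater C] D by (force simp: dist_real_def)
    qed simp
    then show ?thesis
      using e(1) has_field_derivative_transform_within[OF DERIV_const, of e r UNIV "f r" f]
      by (metis UNIV_I)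
  qed
  then show ?thesis
    using has_field_derivative_zero_constant[of J f] assms(2)
    by (auto simp: connected_convex_1 has_field_derivative_at_within)
qed

subsection \<open>Classification\<close>

text \<open>The swap has order four. After one swap the second field becomes the first and receives
  the multiple; three further swaps take \<open>(W, - V1)\<close> through \<open>(- V1, - W)\<close>
  and \<open>(- W, V1)\<close> to \<open>(V1, W)\<close>.\<close>

lemma twist_conserving_add_right:
  assumes "open S" "commuting_fields S V1 V2"
  shows "twist_conserving S V1 V2 V1 (\<lambda>p. V2 p + a *\<^sub>R V1 p)"
proof -
  let ?W = "\<lambda>p. V2 p + a *\<^sub>R V1 p"
  have step: "twist_conserving S V1 V2 Y (\<lambda>p. - X p)" if "twist_conserving S V1 V2 X Y" for X Y
  proof -
    have "commuting_fields S X Y"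
      using that by (simp add: twist_conserving_def)
    then show ?thesis
      by (rule twist_conserving_trans[OF that twist_conserving_swap[OF assms(1)]])
  qed
  have "twist_conserving S V2 (\<lambda>p. - V1 p) ?W (\<lambda>p. - V1 p)"
    using twist_conserving_add[OF assms(1) commuting_fields_swap[OF assms], of "- a"] by simp
  then have "twist_conserving S V1 V2 ?W (\<lambda>p. - V1 p)"
    by (rule twist_conserving_trans[OF twist_conserving_swap[OF assms]])
  from step[OF step[OF step[OF this]]] show ?thesis
    by (simp add: add.commute)
qed

lemma twist_conserving_classified:
  "twist_conserving (shell J) V1 V2 W1 W2 \<Longrightarrow> classified J d W1 W2 \<Longrightarrow> classified J d V1 V2"
  unfolding classified_def using twist_conserving_trans by blast

lemma commuting_classified:
  "commuting_fields (shell J) V1 V2 \<Longrightarrow> of_six_types J d V1 V2 \<Longrightarrow> classified J d V1 V2"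
  unfolding classified_def using twist_conserving_refl by blast

text \<open>A rotation is linear in position, hence smooth in its own right. Its multiples can
  therefore be subtracted from a field even when the other field of the pair is zero.\<close>

lemma rotation_bh_field_in_vfields:
  assumes "open J"
  shows "bh_field J (\<lambda>r. 0) 0 d (\<lambda>r. 0) \<in> vfields (shell J)"
proof -
  let ?L = "\<lambda>p::point. (0::real, cross3 d (snd p))"
  have "bounded_linear ?L"
    by (simp add: linear_conv_bounded_linear[symmetric] linear_iff cross_add_right cross_mult_right)
  then have "smooth_on (shell J) (bh_field J (\<lambda>r. 0) 0 d (\<lambda>r. 0))"
    by (intro smooth_on_cong[OF open_shell[OF assms] _ smooth_on_bounded_linear[OF open_shell[OF assms]]])
      (auto simp: bh_field_eq shell_def)
  then show ?thesis
    by (simp add: vfields_def bh_field_eq shell_def)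
qed

lemma bh_field_zero: "bh_field J (\<lambda>r. 0) 0 0 (\<lambda>r. 0) = (\<lambda>_. 0)"
  by (intro ext) (simp add: bh_field_eq zero_prod_def)

text \<open>Subtracting \<open>N2 / N1\<close> times the first field removes \<open>N2\<close>. The
  commutation equation then reduces to \<open>N1 * c = 0\<close> for the new time coefficient
  \<open>c\<close>, so the second field is a pure rotation about \<open>\<kappa> d\<close>. If
  \<open>\<kappa> \<noteq> 0\<close>, a multiple of it cancels the rotation of the first field,
  which gives \<open>type_B21\<close>.\<close>

lemma classified_no_radial_part:
  assumes J: "open J" "J \<noteq> {}" "J \<subseteq> {0<..}" and "N1 \<noteq> 0"
    and comm: "commuting_fields (shell J) (bh_field J c1 N1 (\<kappa>1 *\<^sub>R d) (\<lambda>r. 0))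
      (bh_field J c2 N2 (\<kappa>2 *\<^sub>R d) (\<lambda>r. 0))" (is "commuting_fields _ ?V1 ?V2")
  shows "classified J d ?V1 ?V2"
proof -
  note S = open_shell[OF J(1)]
  define \<kappa> where "\<kappa> = \<kappa>2 - N2 / N1 * \<kappa>1"
  let ?c = "\<lambda>r. c2 r + (- (N2 / N1)) * c1 r"
  let ?R = "bh_field J (\<lambda>r. 0) 0 (\<kappa> *\<^sub>R d) (\<lambda>r. 0)"
  have "(\<lambda>p. ?V2 p + (- (N2 / N1)) *\<^sub>R ?V1 p) = bh_field J ?c 0 (\<kappa> *\<^sub>R d) (\<lambda>r. 0)"
    using \<open>N1 \<noteq> 0\<close> by (simp only: bh_field_add) (simp add: \<kappa>_def algebra_simps)
  then have tc: "twist_conserving (shell J) ?V1 ?V2 ?V1 (bh_field J ?c 0 (\<kappa> *\<^sub>R d) (\<lambda>r. 0))"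
    using twist_conserving_add_right[OF S comm, of "- (N2 / N1)"] by simp
  then have "?c r = 0" if "r \<in> J" for r
    using that commuting_bh_fields_iff[OF J, of c1 N1 _ "\<lambda>r. 0" ?c 0 _ "\<lambda>r. 0"] \<open>N1 \<noteq> 0\<close>
    unfolding twist_conserving_def commuting_fields_def by force
  then have "bh_field J ?c 0 (\<kappa> *\<^sub>R d) (\<lambda>r. 0) = ?R"
    by (intro bh_field_cong) simp_all
  with tc have tc: "twist_conserving (shell J) ?V1 ?V2 ?V1 ?R"
    by simp
  let ?W = "bh_field J c1 N1 0 (\<lambda>r. 0)"
  have "twist_conserving (shell J) ?V1 ?R ?W ?R"
  proof (cases "\<kappa> = 0")
    case True
    \<comment> \<open>The second field is 0, so the twist is trivial and the first field can be replaced freely.\<close>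
    have V1: "?V1 \<in> vfields (shell J)"
      using comm by (simp add: commuting_fields_def)
    have "(\<lambda>p. ?V1 p + (- \<kappa>1) *\<^sub>R bh_field J (\<lambda>r. 0) 0 d (\<lambda>r. 0) p) = ?W"
      by (simp only: bh_field_add) simp
    then have "?W \<in> vfields (shell J)"
      using add_in_vfields[OF S V1 scaleR_in_vfields[OF S rotation_bh_field_in_vfields[OF J(1), of d], of "- \<kappa>1"]]
      by simp
    then show ?thesis
      using True twist_conserving_zero[OF S V1] by (simp add: bh_field_zero)
  next
    case False
    have "(\<lambda>p. ?V1 p + (- (\<kappa>1 / \<kappa>)) *\<^sub>R ?R p) = ?W"
      using False by (simp only: bh_field_add) simp
    then show ?thesis
      using twist_conserving_add[OF S, of ?V1 ?R "- (\<kappa>1 / \<kappa>)"] tc by (simp add: twist_conserving_def)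
  qed
  with tc have "twist_conserving (shell J) ?V1 ?V2 ?W ?R"
    using twist_conserving_trans by blast
  moreover have "of_six_types J d ?W ?R"
    using \<open>N1 \<noteq> 0\<close> unfolding of_six_types_def type_B21_def by blast
  ultimately show ?thesis
    unfolding classified_def by blast
qed

text \<open>The alternative for \<open>f\<close> separates the types without radial part from those
  with one, and in the latter case confines the zeros of \<open>f\<close> to isolated
  points.\<close>

lemma classified_f1_zero:
  assumes J: "open J" "connected J" "J \<noteq> {}" "J \<subseteq> {0<..}"
    and comm: "commuting_fields (shell J) (bh_field J c1 N1 (\<kappa>1 *\<^sub>R d) (\<lambda>r. 0))
      (bh_field J c2 N2 (\<kappa>2 *\<^sub>R d) f)" (is "commuting_fields _ ?V1 ?V2")
    and f: "(\<forall>r\<in>J. f r = 0) \<or> (\<forall>r\<in>J. \<forall>\<^sub>F s in at r. f s \<noteq> 0)"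
  shows "classified J d ?V1 ?V2"
  using f
proof
  note S = open_shell[OF J(1)]
  assume "\<forall>r\<in>J. f r = 0"
  then have V2: "?V2 = bh_field J c2 N2 (\<kappa>2 *\<^sub>R d) (\<lambda>r. 0)"
    by (intro bh_field_cong) simp_all
  consider "N1 = 0" "N2 = 0" | "N1 \<noteq> 0" | "N1 = 0" "N2 \<noteq> 0"
    by blast
  then show ?thesis
  proof cases
    case 1
    then have "type_B11 J d ?V1 ?V2"
      unfolding V2 type_B11_def by blast
    then show ?thesis
      using commuting_classified[OF comm] by (simp add: of_six_types_def)
  next
    case 2
    then show ?thesis
      using comm classified_no_radial_part[OF J(1,3,4)] unfolding V2 by blast
  next
    \<comment> \<open>A swap exchanges the roles of \<open>N1\<close> and \<open>N2\<close> up to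
      sign. The pair thus lands in \<open>type_B21\<close>, whose swap is
      \<open>type_B31\<close>.\<close>
    case 3
    have V1: "(\<lambda>p. - ?V1 p) = bh_field J (\<lambda>r. - c1 r) (- N1) ((- \<kappa>1) *\<^sub>R d) (\<lambda>r. 0)"
      by (simp add: bh_field_uminus)
    have tc: "twist_conserving (shell J) ?V1 ?V2 ?V2 (\<lambda>p. - ?V1 p)"
      by (rule twist_conserving_swap[OF S comm])
    then have "commuting_fields (shell J) ?V2 (\<lambda>p. - ?V1 p)"
      by (simp add: twist_conserving_def)
    then have "classified J d ?V2 (\<lambda>p. - ?V1 p)"
      unfolding V1 unfolding V2 by (rule classified_no_radial_part[OF J(1,3,4) 3(2)])
    then show ?thesis
      by (rule twist_conserving_classified[OF tc])
  qed
next
  note S = open_shell[OF J(1)]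
  assume nz: "\<forall>r\<in>J. \<forall>\<^sub>F s in at r. f s \<noteq> 0"
  have f0: "\<exists>r\<in>J. f r \<noteq> 0"
  proof -
    obtain r where r: "r \<in> J"
      using J by blast
    then have "\<forall>\<^sub>F s in at r. s \<in> J"
      using J(1) by (simp add: eventually_at_in_open')
    with nz r have "\<forall>\<^sub>F s in at r. s \<in> J \<and> f s \<noteq> 0"
      by (simp add: eventually_conj)
    then show ?thesis
      using eventually_happens[of _ "at r"] by auto
  qed
  have V: "?V1 \<in> vfields (shell J)" "?V2 \<in> vfields (shell J)"
    using comm by (simp_all add: commuting_fields_def)
  \<comment> \<open>With the first radial coefficient zero this is the only remaining condition. It
    gives \<open>deriv c1 = 0\<close> where \<open>f\<close> is nonzero if
    \<open>N1 = N2 = 0\<close>, determines \<open>c2 - (N2 / N1) * c1\<close> if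
    \<open>N1 \<noteq> 0\<close>, and constrains \<open>c1\<close> alone if only \<open>N2\<close>
    is nonzero.\<close>
  have ode: "N2 * c1 r = N1 * c2 r + r * f r * deriv c1 r" if "r \<in> J" for r
    using comm that unfolding commuting_bh_fields_iff[OF J(1,3,4) V] by (simp add: algebra_simps)
  consider "N1 = 0" "N2 = 0" | "N1 \<noteq> 0" | "N1 = 0" "N2 \<noteq> 0"
    by blast
  then show ?thesis
  proof cases
    case 1
    have "\<exists>k. \<forall>r\<in>J. c1 r = k"
    proof (rule deriv_zero_off_isolated_points_imp_constant[OF J(1,2)])
      fix r assume r: "r \<in> J"
      then show "c1 differentiable at r"
        using bh_field_differentiable_coeffs[OF V(1) J(4,1)] by blast
      have "\<forall>\<^sub>F s in at r. f s \<noteq> 0"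
        using nz r by blast
      then show "\<forall>\<^sub>F s in at r. s \<in> J \<longrightarrow> deriv c1 s = 0"
      proof eventually_elim
        case (elim s)
        then show ?case
          using ode[of s] 1 J(4) by auto
      qed
    qed
    then obtain k where "\<And>r. r \<in> J \<Longrightarrow> c1 r = k"
      by blast
    then have "?V1 = bh_field J (\<lambda>r. k) 0 (\<kappa>1 *\<^sub>R d) (\<lambda>r. 0)"
      unfolding 1 by (intro bh_field_cong) simp_all
    then have "type_B12 J d ?V1 ?V2"
      unfolding type_B12_def 1 using f0 by blast
    then show ?thesis
      using commuting_classified[OF comm] by (simp add: of_six_types_def)
  next
    case 2
    let ?c = "\<lambda>r. c2 r + (- (N2 / N1)) * c1 r"
    let ?c' = "\<lambda>r. - (1 / N1) * f r * r * deriv c1 r"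
    let ?\<kappa> = "\<kappa>2 + (- (N2 / N1)) * \<kappa>1"
    have "(\<lambda>p. ?V2 p + (- (N2 / N1)) *\<^sub>R ?V1 p) = bh_field J ?c 0 (?\<kappa> *\<^sub>R d) f"
      using 2 by (simp only: bh_field_add) (simp add: algebra_simps)
    also have "\<dots> = bh_field J ?c' 0 (?\<kappa> *\<^sub>R d) f"
    proof (intro bh_field_cong refl)
      fix r assume "r \<in> J"
      then show "?c r = ?c' r"
        using ode[of r] 2 by (simp add: field_simps)
    qed
    finally have tc: "twist_conserving (shell J) ?V1 ?V2 ?V1 (bh_field J ?c' 0 (?\<kappa> *\<^sub>R d) f)"
      using twist_conserving_add_right[OF S comm, of "- (N2 / N1)"] by simp
    have "type_B22 J d ?V1 (bh_field J ?c' 0 (?\<kappa> *\<^sub>R d) f)"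
      unfolding type_B22_def using 2 f0 by blast
    then show ?thesis
      using tc unfolding classified_def of_six_types_def by blast
  next
    \<comment> \<open>The swap used without radial part would now carry \<open>f\<close> back into
      the first field, so the pair is kept in this order.\<close>
    case 3
    have "\<forall>r\<in>J. c1 r = f r / N2 * r * deriv c1 r"
      using ode 3 by (simp add: field_simps)
    then have "type_B32 J d ?V1 ?V2"
      unfolding type_B32_def using 3 f0 by blast
    then show ?thesis
      using commuting_classified[OF comm] by (simp add: of_six_types_def)
  qed
qed

text \<open>For \<open>a \<noteq> 0\<close>, adding \<open>b / a\<close> times the second field
  removes the radial part of the first. For \<open>a = 0\<close> the relation says
  \<open>f2 = 0\<close>, and a swap suffices. The new second radial coefficient is \<open>f2\<close>
  or \<open>- f1\<close>, hence the alternative is assumed for both.\<close>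

lemma eliminable_and_classified:
  assumes J: "open J" "connected J" "J \<noteq> {}" "J \<subseteq> {0<..}"
    and comm: "commuting_fields (shell J) (bh_field J c1 N1 (\<kappa>1 *\<^sub>R d) f1)
      (bh_field J c2 N2 (\<kappa>2 *\<^sub>R d) f2)" (is "commuting_fields _ ?V1 ?V2")
    and dep: "a \<noteq> 0 \<or> b \<noteq> 0" "\<And>r. r \<in> J \<Longrightarrow> a * f1 r + b * f2 r = 0"
    and f1: "(\<forall>r\<in>J. f1 r = 0) \<or> (\<forall>r\<in>J. \<forall>\<^sub>F s in at r. f1 s \<noteq> 0)"
    and f2: "(\<forall>r\<in>J. f2 r = 0) \<or> (\<forall>r\<in>J. \<forall>\<^sub>F s in at r. f2 s \<noteq> 0)"
  shows "f1_eliminable J ?V1 ?V2 \<and> classified J d ?V1 ?V2"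
proof -
  note S = open_shell[OF J(1)]
  have main: ?thesis if tc: "twist_conserving (shell J) ?V1 ?V2
      (bh_field J e1 M1 (\<mu>1 *\<^sub>R d) (\<lambda>r. 0)) (bh_field J e2 M2 (\<mu>2 *\<^sub>R d) g)"
    and g: "(\<forall>r\<in>J. g r = 0) \<or> (\<forall>r\<in>J. \<forall>\<^sub>F s in at r. g s \<noteq> 0)" for e1 M1 \<mu>1 e2 M2 \<mu>2 g
  proof
    show "f1_eliminable J ?V1 ?V2"
      using tc unfolding f1_eliminable_def by blast
    have "classified J d (bh_field J e1 M1 (\<mu>1 *\<^sub>R d) (\<lambda>r. 0)) (bh_field J e2 M2 (\<mu>2 *\<^sub>R d) g)"
      using tc g by (intro classified_f1_zero J) (simp_all add: twist_conserving_def)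
    then show "classified J d ?V1 ?V2"
      by (rule twist_conserving_classified[OF tc])
  qed
  show ?thesis
  proof (cases "a = 0")
    case False
    have "(\<lambda>p. ?V1 p + (b / a) *\<^sub>R ?V2 p) =
        bh_field J (\<lambda>r. c1 r + b / a * c2 r) (N1 + b / a * N2) ((\<kappa>1 + b / a * \<kappa>2) *\<^sub>R d)
          (\<lambda>r. f1 r + b / a * f2 r)"
      by (simp only: bh_field_add) (simp add: scaleR_add_left)
    also have "\<dots> = bh_field J (\<lambda>r. c1 r + b / a * c2 r) (N1 + b / a * N2)
        ((\<kappa>1 + b / a * \<kappa>2) *\<^sub>R d) (\<lambda>r. 0)"
      using dep False by (intro bh_field_cong) (simp_all add: field_simps)
    finally have "twist_conserving (shell J) ?V1 ?V2 (bh_field J (\<lambda>r. c1 r + b / a * c2 r)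
        (N1 + b / a * N2) ((\<kappa>1 + b / a * \<kappa>2) *\<^sub>R d) (\<lambda>r. 0)) ?V2"
      using twist_conserving_add[OF S comm, of "b / a"] by simp
    then show ?thesis
      using f2 by (rule main)
  next
    case True
    then have "f2 r = 0" if "r \<in> J" for r
      using dep that by auto
    then have V2: "?V2 = bh_field J c2 N2 (\<kappa>2 *\<^sub>R d) (\<lambda>r. 0)"
      by (intro bh_field_cong) simp_all
    have V1: "(\<lambda>p. - ?V1 p) = bh_field J (\<lambda>r. - c1 r) (- N1) ((- \<kappa>1) *\<^sub>R d) (\<lambda>r. - f1 r)"
      by (simp add: bh_field_uminus)
    have "twist_conserving (shell J) ?V1 ?V2 (bh_field J c2 N2 (\<kappa>2 *\<^sub>R d) (\<lambda>r. 0))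
        (bh_field J (\<lambda>r. - c1 r) (- N1) ((- \<kappa>1) *\<^sub>R d) (\<lambda>r. - f1 r))"
      using twist_conserving_swap[OF S comm] unfolding V1 V2 .
    moreover have "(\<forall>r\<in>J. - f1 r = 0) \<or> (\<forall>r\<in>J. \<forall>\<^sub>F s in at r. - f1 s \<noteq> 0)"
      using f1 by simp
    ultimately show ?thesis
      by (rule main)
  qed
qed

section \<open>The common rotation axis, density of the local intervals, the converse\<close>

lemma parallel_of_cross_zero:
  assumes "cross3 d1 d2 = 0"
  obtains d \<kappa>1 \<kappa>2 where "d \<noteq> 0" "d1 = \<kappa>1 *\<^sub>R d" "d2 = \<kappa>2 *\<^sub>R d"
proof (cases "d1 = 0")
  case False
  have "collinear {0, d1, d2}"
    using assms cross_eq_0 by blast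
  then obtain c where "d2 = c *\<^sub>R d1"
    using False by (auto simp: collinear_lemma)
  then show ?thesis
    using that[of d1 1 c] False by simp
next
  case True
  show ?thesis
  proof (cases "d2 = 0")
    case True
    then show ?thesis
      \<comment> \<open>Without any rotation the axis is arbitrary; some nonzero vector still has to
        be named.\<close>
      using that[of "axis 1 1" 0 0] \<open>d1 = 0\<close> by simp
  next
    case False
    then show ?thesis
      using that[of d2 0 1] \<open>d1 = 0\<close> by simp
  qed
qed

text \<open>Either some ball around \<open>r\<close> misses the open set \<open>?N\<close> and is
  itself a local interval on which both functions vanish, or points of \<open>?N\<close> lie
  arbitrarily close, each the centre of a local interval.\<close>

lemma local_intervals_dense:
  assumes "open I" "continuous_on I f1" "continuous_on I f2"
  shows "I \<subseteq> closure (\<Union> {J. local_interval I f1 f2 J})"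
proof
  let ?U = "\<Union> {J. local_interval I f1 f2 J}"
  let ?N = "{r \<in> I. f1 r \<noteq> 0 \<or> f2 r \<noteq> 0}"
  have "open (I \<inter> f1 -` (- {0}))" "open (I \<inter> f2 -` (- {0}))"
    using assms by (auto intro!: continuous_open_preimage)
  moreover have "?N = (I \<inter> f1 -` (- {0})) \<union> (I \<inter> f2 -` (- {0}))"
    by blast
  ultimately have "open ?N"
    by (metis open_Un)
  have N: "?N \<subseteq> ?U"
  proof
    fix r assume "r \<in> ?N"
    then obtain e where "e > 0" "ball r e \<subseteq> ?N"
      using \<open>open ?N\<close> open_contains_ball by blast
    then have "local_interval I f1 f2 (ball r e)"
      by (auto simp: local_interval_def)
    then show "r \<in> ?U"
      using \<open>e > 0\<close> by (intro UnionI[of "ball r e"]) auto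
  qed
  fix r assume r: "r \<in> I"
  show "r \<in> closure ?U"
    unfolding closure_approachable
  proof (intro allI impI)
    fix e :: real assume "e > 0"
    obtain e' where e': "e' > 0" "ball r e' \<subseteq> I"
      using assms(1) r open_contains_ball by blast
    let ?B = "ball r (min e e')"
    show "\<exists>y\<in>?U. dist y r < e"
    proof (cases "?B \<inter> ?N = {}")
      case True
      have "?B \<subseteq> I"
        using e'(2) by auto
      with True have "local_interval I f1 f2 ?B"
        using \<open>e > 0\<close> e'(1) by (auto simp: local_interval_def)
      then show ?thesis
        using \<open>e > 0\<close> e'(1) by (intro bexI[of _ r]) (auto intro!: exI[of _ ?B])
    next
      case False
      then obtain y where "y \<in> ?B" "y \<in> ?N"
        by blast
      then show ?thesis
        using N by (intro bexI[of _ y]) (auto simp: dist_commute)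
    qed
  qed
qed

text \<open>This is the converse of the classification. Multiples of one \<open>d\<close> have zero
  cross product and the first radial coefficient is zero, so only the time equation remains, and the
  form of each type solves it.\<close>

lemma six_types_commute:
  assumes I: "open I" "I \<noteq> {}" "I \<subseteq> {0<..}"
    and W: "W1 \<in> vfields (shell I)" "W2 \<in> vfields (shell I)" and types: "of_six_types I d W1 W2"
  shows "commuting_fields (shell I) W1 W2"
proof -
  have par: "cross3 (a *\<^sub>R d) (b *\<^sub>R d) = 0" for a b
    by (simp add: cross_mult_left cross_mult_right)
  show ?thesis
    using types unfolding of_six_types_def
  proof (elim disjE)
    assume "type_B11 I d W1 W2"
    then show ?thesis
      unfolding type_B11_def using W by (auto simp: commuting_bh_fields_iff[OF I] par)
  next
    assume "type_B21 I d W1 W2"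
    then show ?thesis
      unfolding type_B21_def using W by (auto simp: commuting_bh_fields_iff[OF I] par)
  next
    assume "type_B31 I d W1 W2"
    then show ?thesis
      unfolding type_B31_def using W by (auto simp: commuting_bh_fields_iff[OF I] par)
  next
    assume "type_B12 I d W1 W2"
    then show ?thesis
      unfolding type_B12_def using W by (auto simp: commuting_bh_fields_iff[OF I] par)
  next
    assume "type_B22 I d W1 W2"
    then show ?thesis
      unfolding type_B22_def using W by (auto simp: commuting_bh_fields_iff[OF I] par)
  next
    assume "type_B32 I d W1 W2"
    then obtain c1 c2 N2 \<kappa>1 \<kappa>2 f2 where B32: "N2 \<noteq> 0" "\<And>r. r \<in> I \<Longrightarrow> c1 r = f2 r / N2 * r * deriv c1 r"
      "W1 = bh_field I c1 0 (\<kappa>1 *\<^sub>R d) (\<lambda>r. 0)" "W2 = bh_field I c2 N2 (\<kappa>2 *\<^sub>R d) f2"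
      unfolding type_B32_def by blast
    have "N2 * c1 r = r * (f2 r * deriv c1 r)" if "r \<in> I" for r
      using arg_cong[OF B32(2)[OF that], of "(*) N2"] B32(1) by (simp add: algebra_simps)
    then show ?thesis
      using W unfolding B32(3,4) by (simp add: commuting_bh_fields_iff[OF I] par)
  qed
qed

theorem mainTheorem9:
  fixes I :: "real set" and c1 c2 f1 f2 :: "real \<Rightarrow> real"
    and N1 N2 :: real and d1 d2 :: "real^3"
  assumes "open I" and "connected I" and "I \<noteq> {}" and "I \<subseteq> {0<..}"
    and "commuting_fields (shell I) (bh_field I c1 N1 d1 f1) (bh_field I c2 N2 d2 f2)"
  shows
    "(\<forall>J. connected J \<and> J \<subseteq> {r \<in> I. f1 r \<noteq> 0 \<and> f2 r \<noteq> 0} \<longrightarrow> (\<exists>\<kappa>. \<forall>r\<in>J. f1 r = \<kappa> * f2 r))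
     \<and> (\<forall>J. local_interval I f1 f2 J \<longrightarrow>
            f1_eliminable J (bh_field J c1 N1 d1 f1) (bh_field J c2 N2 d2 f2))
     \<and> I \<subseteq> closure (\<Union> {J. local_interval I f1 f2 J})
     \<and> (\<exists>d \<kappa>1 \<kappa>2. d \<noteq> 0 \<and> d1 = \<kappa>1 *\<^sub>R d \<and> d2 = \<kappa>2 *\<^sub>R d
         \<and> (\<forall>J. local_interval I f1 f2 J \<longrightarrow>
              classified J d (bh_field J c1 N1 d1 f1) (bh_field J c2 N2 d2 f2))
         \<and> (real_analytic_on f1 I \<and> real_analytic_on f2 I \<longrightarrow>
              f1_eliminable I (bh_field I c1 N1 d1 f1) (bh_field I c2 N2 d2 f2) \<and>
              classified I d (bh_field I c1 N1 d1 f1) (bh_field I c2 N2 d2 f2)))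
     \<and> (\<forall>d W1 W2. d \<noteq> 0 \<and> W1 \<in> vfields (shell I) \<and> W2 \<in> vfields (shell I) \<and> of_six_types I d W1 W2
          \<longrightarrow> commuting_fields (shell I) W1 W2)"
proof -
  note I = assms(1-4) and comm = assms(5)
  have V: "bh_field I c1 N1 d1 f1 \<in> vfields (shell I)" "bh_field I c2 N2 d2 f2 \<in> vfields (shell I)"
    using comm by (simp_all add: commuting_fields_def)
  have diff: "f1 differentiable at r" "f2 differentiable at r" if "r \<in> I" for r
    using bh_field_differentiable_coeffs(2) V I that by blast+
  have cross: "cross3 d1 d2 = 0" and wronskian: "\<And>r. r \<in> I \<Longrightarrow> f1 r * deriv f2 r = f2 r * deriv f1 r"
    using comm unfolding commuting_bh_fields_iff[OF I(1,3,4) V] by blast+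
  \<comment> \<open>The axis is fixed once on \<open>I\<close>, so the same \<open>d\<close> serves
    all local intervals and the global statement.\<close>
  obtain d \<kappa>1 \<kappa>2 where d: "d \<noteq> 0" "d1 = \<kappa>1 *\<^sub>R d" "d2 = \<kappa>2 *\<^sub>R d"
    by (rule parallel_of_cross_zero[OF cross])
  have local_part: "f1_eliminable J (bh_field J c1 N1 d1 f1) (bh_field J c2 N2 d2 f2) \<and>
      classified J d (bh_field J c1 N1 d1 f1) (bh_field J c2 N2 d2 f2)"
    if L: "local_interval I f1 f2 J" for J
  proof -
    have J: "open J" "connected J" "J \<noteq> {}" "J \<subseteq> I" "J \<subseteq> {0<..}"
      using L I(4) by (auto simp: local_interval_def)
    have commJ: "commuting_fields (shell J) (bh_field J c1 N1 d1 f1) (bh_field J c2 N2 d2 f2)"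
      using J(4) by (intro commuting_fields_subset[OF open_shell[OF I(1)] open_shell[OF J(1)] _ comm]
          bh_field_restrict) (auto simp: shell_def)
    have ev: "\<forall>\<^sub>F s in at r. f s \<noteq> 0" if "r \<in> J" "\<And>s. s \<in> J \<Longrightarrow> f s \<noteq> 0" for r and f :: "real \<Rightarrow> real"
      using eventually_at_in_open'[OF J(1) that(1)] by eventually_elim (rule that(2))
    consider "\<forall>r\<in>J. f1 r = 0 \<and> f2 r = 0" | "\<And>r. r \<in> J \<Longrightarrow> f1 r \<noteq> 0 \<or> f2 r \<noteq> 0"
      using L by (auto simp: local_interval_def)
    then show ?thesis
    proof cases
      case 1
      then show ?thesis
        using eliminable_and_classified[OF J(1,2,3,5) commJ[unfolded d(2,3)], of 1 0] unfolding d(2,3)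
        by simp
    next
      case 2
      have "\<exists>a b. (a \<noteq> 0 \<or> b \<noteq> 0) \<and> (\<forall>r\<in>J. a * f1 r + b * f2 r = 0)"
        by (rule linearly_dependent_of_wronskian_zero[OF J(2,3)]) (use diff wronskian 2 J(4) in blast)+
      then obtain a b where ab: "a \<noteq> 0 \<or> b \<noteq> 0" "\<And>r. r \<in> J \<Longrightarrow> a * f1 r + b * f2 r = 0"
        by blast
      \<comment> \<open>For \<open>b = 0\<close> the relation forces \<open>f1 = 0\<close> on
        \<open>J\<close>; for \<open>b \<noteq> 0\<close> a zero of \<open>f1\<close> would be a
        common zero, which this case excludes.\<close>
      have "(\<forall>r\<in>J. f1 r = 0) \<or> (\<forall>r\<in>J. f1 r \<noteq> 0)"
        using ab 2 by (cases "b = 0") force+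
      moreover have "(\<forall>r\<in>J. f2 r = 0) \<or> (\<forall>r\<in>J. f2 r \<noteq> 0)"
        using ab 2 by (cases "a = 0") force+
      ultimately have F: "(\<forall>r\<in>J. f1 r = 0) \<or> (\<forall>r\<in>J. \<forall>\<^sub>F s in at r. f1 s \<noteq> 0)"
        "(\<forall>r\<in>J. f2 r = 0) \<or> (\<forall>r\<in>J. \<forall>\<^sub>F s in at r. f2 s \<noteq> 0)"
        using ev by blast+
      show ?thesis
        unfolding d(2,3) by (rule eliminable_and_classified[OF J(1,2,3,5) commJ[unfolded d(2,3)] ab F])
    qed
  qed
  have analytic_part: "f1_eliminable I (bh_field I c1 N1 d1 f1) (bh_field I c2 N2 d2 f2) \<and>
      classified I d (bh_field I c1 N1 d1 f1) (bh_field I c2 N2 d2 f2)"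
    if an: "real_analytic_on f1 I" "real_analytic_on f2 I"
  proof -
    note dich = real_analytic_identity[OF I(1,2)]
    \<comment> \<open>Near a radius with \<open>f2 \<noteq> 0\<close> the Wronskian gives
      \<open>f1 = k * f2\<close>. The analytic function \<open>f1 - k * f2\<close> vanishes around
      that radius, so the identity theorem extends the relation to all of \<open>I\<close>.\<close>
    have "\<exists>a b. (a \<noteq> 0 \<or> b \<noteq> 0) \<and> (\<forall>r\<in>I. a * f1 r + b * f2 r = 0)"
    proof (cases "\<forall>r\<in>I. f2 r = 0")
      case True
      then show ?thesis
        by (intro exI[of _ 0] exI[of _ 1]) simp
    next
      case False
      then obtain r where r: "r \<in> I" "f2 r \<noteq> 0"
        by blast
      have "open (I \<inter> f2 -` (- {0}))"
        using diff I(1) by (intro continuous_open_preimage continuous_at_imp_continuous_on)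
          (auto intro: differentiable_imp_continuous_within)
      then obtain e where e: "e > 0" "ball r e \<subseteq> I \<inter> f2 -` (- {0})"
        using r open_contains_ball by blast
      have "\<exists>k. \<forall>s\<in>ball r e. f1 s = k * f2 s"
        using e(2) by (intro parallel_of_wronskian_zero) (auto intro: diff wronskian)
      then obtain k where k: "\<And>s. s \<in> ball r e \<Longrightarrow> f1 s = k * f2 s"
        by blast
      have "\<forall>\<^sub>F s in at r. s \<in> ball r e"
        using e(1) by (intro eventually_at_in_open') auto
      then have ev: "\<forall>\<^sub>F s in at r. f1 s + (- k) * f2 s = 0"
        by eventually_elim (simp add: k)
      have "\<not> (\<forall>\<^sub>F s in at r. f1 s + (- k) * f2 s \<noteq> 0)"
      proof
        assume "\<forall>\<^sub>F s in at r. f1 s + (- k) * f2 s \<noteq> 0"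
        with ev have "\<forall>\<^sub>F s in at r. False"
          by eventually_elim simp
        then show False
          by simp
      qed
      then have "\<forall>s\<in>I. f1 s + (- k) * f2 s = 0"
        using dich[OF real_analytic_on_linear_combination[OF an, of "- k"]] r(1) by blast
      then show ?thesis
        by (intro exI[of _ 1] exI[of _ "- k"]) simp
    qed
    then obtain a b where ab: "a \<noteq> 0 \<or> b \<noteq> 0" "\<And>r. r \<in> I \<Longrightarrow> a * f1 r + b * f2 r = 0"
      by blast
    show ?thesis
      unfolding d(2,3)
      by (rule eliminable_and_classified[OF I comm[unfolded d(2,3)] ab dich[OF an(1)] dich[OF an(2)]])
  qed
  show ?thesis
  proof (intro conjI allI impI)
    fix J assume J: "connected J \<and> J \<subseteq> {r \<in> I. f1 r \<noteq> 0 \<and> f2 r \<noteq> 0}"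
    then have "r \<in> I" "f2 r \<noteq> 0" if "r \<in> J" for r
      using that by auto
    then show "\<exists>\<kappa>. \<forall>r\<in>J. f1 r = \<kappa> * f2 r"
      using J by (intro parallel_of_wronskian_zero) (simp_all add: diff wronskian)
  next
    show "I \<subseteq> closure (\<Union> {J. local_interval I f1 f2 J})"
      using diff by (intro local_intervals_dense I(1) continuous_at_imp_continuous_on)
        (auto intro: differentiable_imp_continuous_within)
  next
    show "\<exists>d \<kappa>1 \<kappa>2. d \<noteq> 0 \<and> d1 = \<kappa>1 *\<^sub>R d \<and> d2 = \<kappa>2 *\<^sub>R d
      \<and> (\<forall>J. local_interval I f1 f2 J \<longrightarrow>
           classified J d (bh_field J c1 N1 d1 f1) (bh_field J c2 N2 d2 f2))
      \<and> (real_analytic_on f1 I \<and> real_analytic_on f2 I \<longrightarrow>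
           f1_eliminable I (bh_field I c1 N1 d1 f1) (bh_field I c2 N2 d2 f2) \<and>
           classified I d (bh_field I c1 N1 d1 f1) (bh_field I c2 N2 d2 f2))"
      using d local_part analytic_part by (intro exI[of _ d] exI[of _ \<kappa>1] exI[of _ \<kappa>2] conjI allI impI) blast+
  qed (use local_part six_types_commute[OF I(1,3,4)] in blast)+
qed

end
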